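(* Let $G$ be an infinite, connected, vertex-transitive, simple cubic graph of girth $4$. Then $$y_1\le\mu(G)\le y_2,$$ where $y_1=12^{1/6}$ and $y_2=1/\zeta$, with $\zeta$ the smallest positive root of the equation $$2x^2(1+x+x^2)=1.$$ Moreover, the upper bound $y_2$ is sharp, i.e. there exists such a graph $G$ with $\mu(G)=y_2$.
   Context: Cubic means that every vertex has degree 3; girth is the length of a shortest cycle. A self-avoiding walk (SAW) is a walk with no repeated vertex; $\sigma_n(v)$ is the number of $n$-step SAWs from $v$, and the connective constant is $\mu(G)=\lim_{n\to\infty}\sigma_n(v)^{1/n}$ (the limit exists and is independent of $v$). *)

theory Defs
  imports Complex_Main "HOL-Library.Extended_Nat"
begin

text \<open>
  A graph is given by a vertex set \<open>V\<close> and a set \<open>E\<close> of edges, each edge being a two-element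
  set of vertices. A walk is the nonempty list of the vertices it visits, so that its number of
  steps is one less than the length of the list.
\<close>

definition simple_graph :: "'a set \<Rightarrow> 'a set set \<Rightarrow> bool" where
  "simple_graph V E \<longleftrightarrow> (\<forall>e\<in>E. e \<subseteq> V \<and> card e = 2)"

definition degree :: "'a set set \<Rightarrow> 'a \<Rightarrow> nat" where
  "degree E v = card {e \<in> E. v \<in> e}"

definition cubic :: "'a set \<Rightarrow> 'a set set \<Rightarrow> bool" where
  "cubic V E \<longleftrightarrow> (\<forall>v\<in>V. degree E v = 3)"

definition walk :: "'a set \<Rightarrow> 'a set set \<Rightarrow> 'a list \<Rightarrow> bool" where
  "walk V E p \<longleftrightarrow> p \<noteq> [] \<and> set p \<subseteq> V \<and> successively (\<lambda>u v. {u, v} \<in> E) p"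

definition connected_graph :: "'a set \<Rightarrow> 'a set set \<Rightarrow> bool" where
  "connected_graph V E \<longleftrightarrow> V \<noteq> {} \<and> (\<forall>u\<in>V. \<forall>v\<in>V. \<exists>p. walk V E p \<and> hd p = u \<and> last p = v)"

definition automorphism :: "'a set \<Rightarrow> 'a set set \<Rightarrow> ('a \<Rightarrow> 'a) \<Rightarrow> bool" where
  "automorphism V E f \<longleftrightarrow>
     bij_betw f V V \<and> (\<forall>u\<in>V. \<forall>v\<in>V. {f u, f v} \<in> E \<longleftrightarrow> {u, v} \<in> E)"

definition vertex_transitive :: "'a set \<Rightarrow> 'a set set \<Rightarrow> bool" where
  "vertex_transitive V E \<longleftrightarrow> (\<forall>u\<in>V. \<forall>v\<in>V. \<exists>f. automorphism V E f \<and> f u = v)"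

text \<open>
  The first vertex of a cycle is not repeated at the end of the list, so the list length is
  the length of the cycle.
\<close>

definition cycle :: "'a set \<Rightarrow> 'a set set \<Rightarrow> 'a list \<Rightarrow> bool" where
  "cycle V E c \<longleftrightarrow> walk V E c \<and> distinct c \<and> length c \<ge> 3 \<and> {last c, hd c} \<in> E"

text \<open>The girth of an acyclic graph is \<open>\<infinity>\<close>, the infimum of the empty set.\<close>

definition girth :: "'a set \<Rightarrow> 'a set set \<Rightarrow> enat" where
  "girth V E = (INF c\<in>{c. cycle V E c}. enat (length c))"

definition saws :: "'a set \<Rightarrow> 'a set set \<Rightarrow> nat \<Rightarrow> 'a \<Rightarrow> 'a list set" where
  "saws V E n v = {p. walk V E p \<and> distinct p \<and> hd p = v \<and> length p = Suc n}"

definition num_saws :: "'a set \<Rightarrow> 'a set set \<Rightarrow> nat \<Rightarrow> 'a \<Rightarrow> nat" where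
  "num_saws V E n v = card (saws V E n v)"

text \<open>
  The common limit of \<open>\<sigma>\<^sub>n(v)\<^bsup>1/n\<^esup>\<close> over all vertices \<open>v\<close>. It is a definite description, so
  nothing can be derived about its value unless the limit exists and does not depend on \<open>v\<close>.
\<close>

definition connective_constant :: "'a set \<Rightarrow> 'a set set \<Rightarrow> real" where
  "connective_constant V E =
     (THE \<mu>. \<forall>v\<in>V. (\<lambda>n. root n (real (num_saws V E n v))) \<longlonglongrightarrow> \<mu>)"

definition zeta :: real where
  "zeta = (LEAST x. x > 0 \<and> 2 * x\<^sup>2 * (1 + x + x\<^sup>2) = 1)"

definition y1 :: real where
  "y1 = root 6 12"

definition y2 :: real where
  "y2 = 1 / zeta"

definition infinite_transitive_cubic_girth4 :: "'a set \<Rightarrow> 'a set set \<Rightarrow> bool" where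
  "infinite_transitive_cubic_girth4 V E \<longleftrightarrow>
     simple_graph V E \<and> infinite V \<and> connected_graph V E \<and> vertex_transitive V E \<and>
     cubic V E \<and> girth V E = 4"

end

(*
  Contract the squares of the graph. If each vertex lies in exactly one square, then a self-avoiding
  walk alternates between edges joining two squares and passages of 1, 2 or 3 steps through a square;
  per square there are two passages of each length, and weighting partial passages accordingly gives
  the growth rate 1/zeta as an upper bound. It is attained when the squares form a 4-regular tree.
  For the lower bound, the two passages to a neighbouring corner weigh x + x^3 >= 2 x^2, so the three
  exits of a square may be treated alike, and it suffices that walks in the contracted 4-regular
  graph grow at rate at least sqrt 3: only walks that can be continued forever are counted, and each
  exit that is blocked is charged to an earlier edge that was an alternative exit.

  If some vertex, hence every vertex, lies in two squares, then K_{3,3} and the cube are excluded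
  because the graph is infinite, and the graph has the local structure of a ladder.
*)
theory Submission
  imports Defs "HOL-Library.Countable"
begin

text \<open>Where \<open>12 ^ (1/6)\<close> comes from: with weight \<open>2 * x ^ 3\<close> on each
  exit of a square and rate \<open>sqrt 3\<close> per square, the critical \<open>x\<close>
  satisfies \<open>2 * x ^ 3 * sqrt 3 = 1\<close>, that is \<open>12 * x ^ 6 = 1\<close>. The rate
  \<open>sqrt 3\<close> is the geometric mean of 3 and 1: crossing a square with \<open>r\<close>
  usable exits changes the number of pending edges by at most \<open>2 * r - 4\<close>, so a square
  with a single exit uses up two pending edges and a square with three exits creates at most two,
  while two exits already exceed \<open>sqrt 3\<close>. The obstacle is that an exit may be blocked
  by a finite pocket rather than by a visited square. Such a pocket must also touch the visited set,
  because deleting one square never leaves a finite component, and the parity of the edges leaving a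
  union of squares makes it touch often enough. Lower bounds use generating polynomials truncated by
  the number of blocks crossed. A positive bound uniform in the truncation suffices, and no series
  has to converge. In the ladder case there is room to spare: walks that only move forward already
  give the golden ratio, above \<open>y1\<close>, and forbidding only walks that close a square
  gives the tribonacci constant 1.839..., below \<open>y2\<close> = 1.899....\<close>

section \<open>Limits of roots and counting self-avoiding walks\<close>

text \<open>Fekete's lemma in multiplicative form: the limit is the infimum of the roots. If
  \<open>root m (a m) < r\<close> for one \<open>m\<close>, splitting \<open>n\<close> into a
  multiple of \<open>m\<close> and a remainder bounds \<open>a n\<close> by a constant times
  \<open>r ^ n\<close>.\<close>

lemma fekete_root:
  fixes a :: "nat \<Rightarrow> real"
  assumes nonneg: "\<And>n. a n \<ge> 0" and sub: "\<And>m n. a (m + n) \<le> a m * a n"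
  obtains L where "(\<lambda>n. root n (a n)) \<longlonglongrightarrow> L"
proof -
  define X where "X = (\<lambda>n. root n (a n)) ` {1..}"
  define L where "L = Inf X"
  have X0: "X \<noteq> {}" and bdd: "bdd_below X"
    using nonneg by (auto simp: X_def intro!: bdd_belowI[of _ 0])
  have lower: "L \<le> root n (a n)" if "n \<ge> 1" for n
    unfolding L_def using that bdd by (intro cInf_lower) (auto simp: X_def)
  have L0: "L \<ge> 0"
    unfolding L_def using X0 nonneg by (intro cInf_greatest) (auto simp: X_def)
  have upper: "eventually (\<lambda>n. root n (a n) < s) sequentially" if "s > L" for s
  proof -
    define r where "r = (L + s) / 2"
    have r: "L < r" "r < s" "r > 0" using that L0 by (auto simp: r_def)
    obtain y where "y \<in> X" "y < r"
      using cInf_lessD[OF X0, of r] r unfolding L_def by auto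
    then obtain m where m: "m \<ge> 1" "root m (a m) < r" by (auto simp: X_def)
    have am: "a m \<le> r ^ m"
    proof -
      have "a m = root m (a m) ^ m" using m nonneg by simp
      also have "\<dots> \<le> r ^ m" using m nonneg by (intro power_mono) auto
      finally show ?thesis .
    qed
    have mult: "a (q * m + t) \<le> r ^ (q * m) * a t" for q t
    proof (induction q)
      case (Suc q)
      have "a (Suc q * m + t) \<le> a m * a (q * m + t)"
        using sub[of m "q * m + t"] by (simp add: algebra_simps)
      also have "\<dots> \<le> r ^ m * (r ^ (q * m) * a t)"
        using am Suc nonneg r by (intro mult_mono) auto
      finally show ?case by (simp add: power_add algebra_simps)
    qed simp
    \<comment> \<open>The summand 1 keeps \<open>K\<close> positive even if \<open>a\<close>
      vanishes, so that \<open>root n K\<close> tends to 1.\<close>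
    define K where "K = 1 + (\<Sum>t<m. a t / r ^ t)"
    have K: "K > 0" unfolding K_def using nonneg r
      by (intro add_pos_nonneg sum_nonneg) auto
    have bound: "a n \<le> K * r ^ n" for n
    proof -
      define t where "t = n mod m"
      have t: "t < m" using m by (simp add: t_def)
      have n: "n = (n div m) * m + t" by (simp add: t_def)
      have "a n \<le> r ^ (n div m * m) * a t" using mult[of "n div m" t] n by simp
      also have "\<dots> = r ^ n * (a t / r ^ t)"
        using r by (subst (2) n) (simp add: power_add)
      also have "a t / r ^ t \<le> (\<Sum>t<m. a t / r ^ t)"
        using t nonneg r by (intro member_le_sum) auto
      hence "r ^ n * (a t / r ^ t) \<le> r ^ n * K"
        using r by (intro mult_left_mono) (auto simp: K_def)
      finally show ?thesis by (simp add: mult.commute)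
    qed
    have "(\<lambda>n. root n K * r) \<longlonglongrightarrow> 1 * r"
      using K by (intro tendsto_mult LIMSEQ_root_const) auto
    hence "eventually (\<lambda>n. root n K * r < s) sequentially"
      using r by (intro order_tendstoD) auto
    thus ?thesis using eventually_gt_at_top[of 0]
    proof eventually_elim
      case (elim n)
      have "root n (a n) \<le> root n (K * r ^ n)" using elim bound by simp
      also have "\<dots> = root n K * r" using elim r by (simp add: real_root_mult real_root_power_cancel)
      finally show ?case using elim by simp
    qed
  qed
  have "(\<lambda>n. root n (a n)) \<longlonglongrightarrow> L"
  proof (rule order_tendstoI)
    fix s assume "s < L"
    show "eventually (\<lambda>n. s < root n (a n)) sequentially"
      using eventually_ge_at_top[of 1]
    proof eventually_elim
      case (elim n) thus ?case using lower[of n] \<open>s < L\<close> by linarith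
    qed
  qed (rule upper)
  thus ?thesis by (rule that)
qed

lemma root_limit_le:
  fixes a :: "nat \<Rightarrow> real"
  assumes lim: "(\<lambda>n. root n (a n)) \<longlonglongrightarrow> L"
    and bound: "\<And>n. n \<ge> n0 \<Longrightarrow> a n \<le> C * r ^ n" and "C > 0" "r > 0"
  shows "L \<le> r"
proof -
  have "(\<lambda>n. root n C * r) \<longlonglongrightarrow> 1 * r"
    using assms by (intro tendsto_mult LIMSEQ_root_const) auto
  hence "(\<lambda>n. root n C * r) \<longlonglongrightarrow> r" by simp
  thus ?thesis
  proof (rule LIMSEQ_le[OF lim], intro exI[of _ "Suc n0"] allI impI)
    fix n assume n: "Suc n0 \<le> n"
    have "root n (a n) \<le> root n (C * r ^ n)" using n bound[of n] by simp
    also have "\<dots> = root n C * r" using n assms by (simp add: real_root_mult real_root_power_cancel)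
    finally show "root n (a n) \<le> root n C * r" .
  qed
qed

section \<open>Neighbours and one-step extensions of walks in a cubic graph\<close>

locale cubic_graph =
  fixes V :: "'a set" and E :: "'a set set"
  assumes simple: "simple_graph V E" and cubic: "cubic V E"
begin

definition nbrs :: "'a \<Rightarrow> 'a set" where
  "nbrs u = {v. {u, v} \<in> E}"

lemma nbrs_sym: "v \<in> nbrs u \<longleftrightarrow> u \<in> nbrs v"
  by (simp add: nbrs_def insert_commute)

lemma nbrsD:
  assumes "v \<in> nbrs u"
  shows "u \<in> V" "v \<in> V" "u \<noteq> v"
  using assms simple by (force simp: nbrs_def simple_graph_def)+

lemma card_nbrs:
  assumes "u \<in> V"
  shows "card (nbrs u) = 3"
proof -
  have "bij_betw (\<lambda>v. {u, v}) (nbrs u) {e \<in> E. u \<in> e}"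
  proof (rule bij_betwI')
    fix e assume e: "e \<in> {e \<in> E. u \<in> e}"
    hence "card e = 2" using simple by (auto simp: simple_graph_def)
    then obtain a b where "e = {a, b}" by (auto simp: card_2_iff)
    thus "\<exists>v\<in>nbrs u. e = {u, v}" using e by (auto simp: nbrs_def insert_commute)
  qed (auto simp: nbrs_def doubleton_eq_iff)
  thus ?thesis using cubic assms
    by (auto simp: cubic_def degree_def dest: bij_betw_same_card)
qed

lemma finite_nbrs [simp]: "finite (nbrs u)"
proof (cases "u \<in> V")
  case True thus ?thesis using card_nbrs[of u] card_ge_0_finite by force
next
  case False hence "nbrs u = {}" using nbrsD by auto
  thus ?thesis by simp
qed

lemma walk_append_iff:
  assumes "p \<noteq> []" "q \<noteq> []"
  shows "walk V E (p @ q) \<longleftrightarrow> walk V E p \<and> walk V E q \<and> hd q \<in> nbrs (last p)"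
  using assms by (auto simp: walk_def successively_append_iff nbrs_def)

lemma walk_Cons_iff:
  "walk V E (a # p) \<longleftrightarrow> a \<in> V \<and> (p = [] \<or> (walk V E p \<and> hd p \<in> nbrs a))"
  by (cases p) (auto simp: walk_def nbrs_def)

lemma saws_Suc:
  "saws V E (Suc n) v =
     (\<lambda>(p, w). p @ [w]) ` (SIGMA p:saws V E n v. nbrs (last p) - set p)"
proof (intro equalityI subsetI)
  fix q assume q: "q \<in> saws V E (Suc n) v"
  hence "q \<noteq> []" by (auto simp: saws_def)
  then obtain p w where qp: "q = p @ [w]" by (metis rev_exhaust)
  have "p \<noteq> []" using q qp by (auto simp: saws_def)
  hence "p \<in> saws V E n v" "w \<in> nbrs (last p) - set p"
    using q qp walk_append_iff[of p "[w]"] by (auto simp: saws_def)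
  thus "q \<in> (\<lambda>(p, w). p @ [w]) ` (SIGMA p:saws V E n v. nbrs (last p) - set p)"
    using qp by force
next
  fix q assume "q \<in> (\<lambda>(p, w). p @ [w]) ` (SIGMA p:saws V E n v. nbrs (last p) - set p)"
  then obtain p w where qp: "q = p @ [w]" "p \<in> saws V E n v" "w \<in> nbrs (last p)" "w \<notin> set p"
    by auto
  moreover have "p \<noteq> []" using qp by (auto simp: saws_def)
  moreover have "walk V E [w]" using qp nbrsD by (auto simp: walk_def)
  ultimately show "q \<in> saws V E (Suc n) v"
    using walk_append_iff[of p "[w]"] by (auto simp: saws_def)
qed

lemma finite_saws: "finite (saws V E n v)"
proof (induction n)
  case 0
  have "saws V E 0 v \<subseteq> {[v]}" by (auto simp: saws_def length_Suc_conv)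
  thus ?case using finite_subset by blast
next
  case (Suc n) thus ?case unfolding saws_Suc by (intro finite_imageI finite_SigmaI) auto
qed

lemma sum_saws_Suc:
  fixes f :: "'a list \<Rightarrow> real"
  shows "(\<Sum>p\<in>saws V E (Suc n) v. f (rev p)) =
     (\<Sum>p\<in>saws V E n v. \<Sum>w\<in>nbrs (last p) - set p. f (w # rev p))"
proof -
  have inj: "inj_on (\<lambda>(p, w). p @ [w]) (SIGMA p:saws V E n v. nbrs (last p) - set p)"
    by (auto simp: inj_on_def)
  show ?thesis unfolding saws_Suc
    by (subst sum.reindex[OF inj], subst sum.Sigma)
       (auto simp: finite_saws o_def case_prod_unfold)
qed

text \<open>The weights are functions of the reversed walk, so the current position is the head.\<close>

lemma num_saws_le_weight:
  fixes f :: "'a list \<Rightarrow> real"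
  assumes "n \<ge> n0" and lam: "l > 0" and c: "c > 0"
    and lb: "\<And>p. c \<le> f p"
    and step: "\<And>n p. n \<ge> n0 \<Longrightarrow> p \<in> saws V E n v \<Longrightarrow>
                 (\<Sum>w\<in>nbrs (last p) - set p. f (w # rev p)) \<le> l * f (rev p)"
  shows "real (num_saws V E n v) \<le>
           ((1 + (\<Sum>p\<in>saws V E n0 v. f (rev p))) / c / l ^ n0) * l ^ n"
proof -
  define D where "D = (\<Sum>p\<in>saws V E n0 v. f (rev p))"
  have "(\<Sum>p\<in>saws V E n v. f (rev p)) \<le> D / l ^ n0 * l ^ n"
    using \<open>n \<ge> n0\<close>
  proof (induction n rule: dec_induct)
    case base thus ?case using lam by (simp add: D_def)
  next
    case (step n)
    have "(\<Sum>p\<in>saws V E (Suc n) v. f (rev p)) \<le> (\<Sum>p\<in>saws V E n v. l * f (rev p))"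
      unfolding sum_saws_Suc using step assms(5) by (intro sum_mono) auto
    also have "\<dots> \<le> l * (D / l ^ n0 * l ^ n)"
      unfolding sum_distrib_left[symmetric] using step.IH lam by (intro mult_left_mono) auto
    finally show ?case by (simp add: algebra_simps)
  qed
  moreover have "real (num_saws V E n v) * c \<le> (\<Sum>p\<in>saws V E n v. f (rev p))"
    unfolding num_saws_def using lb sum_bounded_below[of "saws V E n v" c "\<lambda>p. f (rev p)"] by auto
  \<comment> \<open>Passing from \<open>D\<close> to \<open>1 + D\<close> makes the constant
    positive even when no walk of length \<open>n0\<close> exists, as \<open>root_limit_le\<close>
    demands.\<close>
  moreover have "D / l ^ n0 * l ^ n \<le> (1 + D) / l ^ n0 * l ^ n"
    using lam by (intro mult_right_mono divide_right_mono) auto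
  ultimately have "real (num_saws V E n v) * c \<le> (1 + D) / l ^ n0 * l ^ n" by linarith
  hence "real (num_saws V E n v) \<le> (1 + D) / l ^ n0 * l ^ n / c"
    by (rule pos_le_divide_eq[OF c, THEN iffD2])
  thus ?thesis by (simp add: D_def mult_ac)
qed

section \<open>Truncated generating functions of self-avoiding walks\<close>

text \<open>
  Crossing a block, leaving edge included, takes at most four steps; a walk that has just crossed
  \<open>N\<close> blocks therefore has between \<open>N + 1\<close> and \<open>4 N + 1\<close> vertices.
\<close>

definition avoiding :: "'a set \<Rightarrow> 'a \<Rightarrow> nat \<Rightarrow> 'a list set" where
  "avoiding S u N = {p. walk V E p \<and> distinct p \<and> hd p = u \<and> set p \<inter> S = {} \<and>
                        N < length p \<and> length p \<le> Suc (4 * N)}"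

text \<open>The exponent counts vertices rather than steps, so weights multiply exactly when two
  walks are concatenated along an edge. The length window in \<open>avoiding\<close> makes this a
  finite sum for every \<open>x\<close>.\<close>

definition gf :: "real \<Rightarrow> 'a set \<Rightarrow> 'a \<Rightarrow> nat \<Rightarrow> real" where
  "gf x S u N = (\<Sum>p\<in>avoiding S u N. x ^ length p)"

lemma avoiding_subset: "avoiding S u N \<subseteq> (\<Union>n\<in>{N..4*N}. saws V E n u)"
proof
  fix p assume p: "p \<in> avoiding S u N"
  then obtain n where n: "length p = Suc n" by (cases p) (auto simp: avoiding_def)
  thus "p \<in> (\<Union>n\<in>{N..4*N}. saws V E n u)"
    using p by (auto simp: avoiding_def saws_def intro!: bexI[of _ n])
qed

lemma finite_avoiding: "finite (avoiding S u N)"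
  by (rule finite_subset[OF avoiding_subset]) (auto simp: finite_saws)

lemma gf_nonneg: "x \<ge> 0 \<Longrightarrow> gf x S u N \<ge> 0"
  by (auto simp: gf_def intro: sum_nonneg)

lemma gf_0:
  assumes "u \<in> V" "u \<notin> S"
  shows "gf x S u 0 = x"
proof -
  have "p = [hd p]" if "length p = Suc 0" for p :: "'a list"
    using that by (cases p) auto
  hence "avoiding S u 0 = {[u]}"
    using assms by (fastforce simp: avoiding_def walk_def le_Suc_eq)
  thus ?thesis by (simp add: gf_def)
qed

text \<open>
  A walk that crosses the block \<open>B\<close> along \<open>q\<close> and then leaves it for good determines \<open>q\<close>, as its
  longest prefix inside \<open>B\<close>.
\<close>

lemma gf_Suc_ge:
  assumes x: "x \<ge> 0" and Q: "finite Q"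
    and q: "\<And>q u'. (q, u') \<in> Q \<Longrightarrow> walk V E q \<and> distinct q \<and> hd q = u \<and> set q \<subseteq> B \<and>
              length q \<le> 4 \<and> u' \<in> nbrs (last q)"
    and BS: "B \<inter> S = {}"
  shows "(\<Sum>(q, u')\<in>Q. x ^ length q * gf x (S \<union> B) u' N) \<le> gf x S u (Suc N)"
proof -
  define X where "X = (SIGMA z:Q. avoiding (S \<union> B) (snd z) N)"
  define h where "h = (\<lambda>(z :: 'a list \<times> 'a, r :: 'a list). fst z @ r)"
  have dec: "takeWhile (\<lambda>y. y \<in> B) (q @ r) = q" "hd r = u'"
    if "(q, u') \<in> Q" "r \<in> avoiding (S \<union> B) u' N" for q u' r
  proof -
    have "r \<noteq> []" "set r \<inter> B = {}" using that(2) by (auto simp: avoiding_def)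
    hence "takeWhile (\<lambda>y. y \<in> B) r = []" by (cases r) auto
    moreover have "\<forall>y\<in>set q. y \<in> B" using q[OF that(1)] by auto
    ultimately show "takeWhile (\<lambda>y. y \<in> B) (q @ r) = q" by simp
    show "hd r = u'" using that(2) by (auto simp: avoiding_def)
  qed
  have inj: "inj_on h X"
  proof (rule inj_onI)
    fix z1 z2 assume z: "z1 \<in> X" "z2 \<in> X" "h z1 = h z2"
    obtain q1 u1 r1 where 1: "z1 = ((q1, u1), r1)" by (metis prod.exhaust)
    obtain q2 u2 r2 where 2: "z2 = ((q2, u2), r2)" by (metis prod.exhaust)
    have m: "(q1, u1) \<in> Q" "(q2, u2) \<in> Q" "r1 \<in> avoiding (S \<union> B) u1 N"
      "r2 \<in> avoiding (S \<union> B) u2 N" using z 1 2 by (auto simp: X_def)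
    have e: "q1 @ r1 = q2 @ r2" using z 1 2 by (simp add: h_def)
    have "q1 = q2" using dec(1)[OF m(1) m(3)] dec(1)[OF m(2) m(4)] e by simp
    moreover have "r1 = r2" using e calculation by simp
    moreover have "u1 = u2" using dec(2)[OF m(1) m(3)] dec(2)[OF m(2) m(4)] calculation by simp
    ultimately show "z1 = z2" using 1 2 by simp
  qed
  have sub: "h ` X \<subseteq> avoiding S u (Suc N)"
  proof
    fix p assume "p \<in> h ` X"
    then obtain q u' r where p: "p = q @ r" and m: "(q, u') \<in> Q" "r \<in> avoiding (S \<union> B) u' N"
      by (auto simp: X_def h_def)
    note qq = q[OF m(1)]
    have ne: "q \<noteq> []" "r \<noteq> []" using qq m(2) by (auto simp: walk_def avoiding_def)
    have "walk V E p" using qq m(2) ne p walk_append_iff by (auto simp: avoiding_def)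
    moreover have "length q \<ge> 1" using ne by (simp add: Suc_le_eq)
    ultimately show "p \<in> avoiding S u (Suc N)"
      using qq m(2) p ne BS by (auto simp: avoiding_def)
  qed
  have "(\<Sum>(q, u')\<in>Q. x ^ length q * gf x (S \<union> B) u' N) =
        (\<Sum>z\<in>Q. \<Sum>r\<in>avoiding (S \<union> B) (snd z) N. x ^ length (h (z, r)))"
    by (auto intro!: sum.cong simp: gf_def h_def sum_distrib_left power_add)
  also have "\<dots> = (\<Sum>w\<in>X. x ^ length (h w))"
    unfolding X_def using Q by (subst sum.Sigma) (auto simp: finite_avoiding case_prod_unfold)
  also have "\<dots> = (\<Sum>p\<in>h ` X. x ^ length p)"
    by (simp add: sum.reindex[OF inj])
  also have "\<dots> \<le> gf x S u (Suc N)"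
    unfolding gf_def using sub x by (intro sum_mono2 finite_avoiding) auto
  finally show ?thesis .
qed

text \<open>Every walk counted by \<open>gf x S u N\<close> has at least \<open>N\<close> steps. If
  the limit were below \<open>1 / x\<close>, these sums would be dominated by tails of a convergent
  geometric series and tend to 0, contradicting the uniform bound \<open>c\<close>.\<close>

lemma root_limit_ge:
  assumes x: "x > 0" and c: "c > 0" and ge: "\<And>N. gf x S u N \<ge> c"
    and lim: "(\<lambda>n. root n (real (num_saws V E n u))) \<longlonglongrightarrow> L"
  shows "1 / x \<le> L"
proof (rule ccontr)
  assume "\<not> 1 / x \<le> L"
  hence "L < 1 / x" by simp
  moreover have "L \<ge> 0"
    using lim by (rule LIMSEQ_le_const) (auto intro!: exI[of _ 0] real_root_ge_zero)
  ultimately obtain r where r: "L < r" "r < 1 / x" "r > 0"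
    using dense[of L "1 / x"] by fastforce
  define t where "t = r * x"
  have t: "0 < t" "t < 1" using r x by (auto simp: t_def field_simps)
  have "eventually (\<lambda>n. root n (real (num_saws V E n u)) < r) sequentially"
    using lim r by (intro order_tendstoD)
  hence "eventually (\<lambda>n. real (num_saws V E n u) \<le> r ^ n) sequentially"
    using eventually_gt_at_top[of 0]
  proof eventually_elim
    case (elim n)
    have "real (num_saws V E n u) = root n (real (num_saws V E n u)) ^ n"
      using elim by simp
    also have "\<dots> \<le> r ^ n" using elim by (intro power_mono) auto
    finally show ?case .
  qed
  then obtain N0 where N0: "\<And>n. n \<ge> N0 \<Longrightarrow> real (num_saws V E n u) \<le> r ^ n"
    by (auto simp: eventually_sequentially)
  have upper: "gf x S u N \<le> x / (1 - t) * t ^ N" if "N \<ge> N0" for N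
  proof -
    have "gf x S u N \<le> (\<Sum>p\<in>(\<Union>n\<in>{N..4*N}. saws V E n u). x ^ length p)"
      unfolding gf_def using x avoiding_subset by (intro sum_mono2) (auto simp: finite_saws)
    also have "\<dots> = (\<Sum>n\<in>{N..4*N}. \<Sum>p\<in>saws V E n u. x ^ length p)"
      by (rule sum.UNION_disjoint) (auto simp: finite_saws, auto simp: saws_def)
    also have "\<dots> = (\<Sum>n\<in>{N..4*N}. real (num_saws V E n u) * x ^ Suc n)"
      by (intro sum.cong refl) (simp add: num_saws_def saws_def)
    also have "\<dots> \<le> (\<Sum>n\<in>{N..4*N}. r ^ n * x ^ Suc n)"
      using N0 that x by (intro sum_mono mult_right_mono) auto
    also have "\<dots> = x * (\<Sum>n\<in>{N..4*N}. t ^ n)"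
      by (simp add: sum_distrib_left t_def power_mult_distrib mult_ac)
    also have "(\<Sum>n\<in>{N..4*N}. t ^ n) = (t ^ N - t ^ Suc (4 * N)) / (1 - t)"
      using t by (subst sum_gp) auto
    also have "\<dots> \<le> t ^ N / (1 - t)"
      using t by (intro divide_right_mono) auto
    finally show ?thesis using x by (simp add: mult_left_mono)
  qed
  have "(\<lambda>N. x / (1 - t) * t ^ N) \<longlonglongrightarrow> x / (1 - t) * 0"
    using t by (intro tendsto_mult tendsto_const LIMSEQ_power_zero) auto
  hence "eventually (\<lambda>N. x / (1 - t) * t ^ N < c) sequentially"
    using c by (intro order_tendstoD) auto
  then obtain N1 where "\<And>N. N \<ge> N1 \<Longrightarrow> x / (1 - t) * t ^ N < c"
    by (auto simp: eventually_sequentially)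
  from this[of "max N0 N1"] upper[of "max N0 N1"] ge[of "max N0 N1"] show False by simp
qed

end

section \<open>Components and transitivity\<close>

context cubic_graph
begin

text \<open>Only the vertices that are entered must avoid \<open>S\<close>; the start
  \<open>u\<close> always belongs, even if \<open>u\<close> is in \<open>S\<close>. Symmetry and
  disjointness from \<open>S\<close> therefore need \<open>u \<notin> S\<close>.\<close>

definition component :: "'a set \<Rightarrow> 'a \<Rightarrow> 'a set" where
  "component S u = {w. (u, w) \<in> {(a, b). b \<in> nbrs a \<and> b \<notin> S}\<^sup>*}"

lemma comp_refl [simp]: "u \<in> component S u"
  by (simp add: component_def)

lemma comp_step: "w \<in> component S u \<Longrightarrow> z \<in> nbrs w \<Longrightarrow> z \<notin> S \<Longrightarrow> z \<in> component S u"
  by (auto simp: component_def intro: rtrancl_into_rtrancl)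

lemma comp_least:
  assumes "u \<in> X" "\<And>w z. w \<in> X \<Longrightarrow> z \<in> nbrs w \<Longrightarrow> z \<notin> S \<Longrightarrow> z \<in> X"
  shows "component S u \<subseteq> X"
proof
  fix w assume "w \<in> component S u"
  hence "(u, w) \<in> {(a, b). b \<in> nbrs a \<and> b \<notin> S}\<^sup>*" by (simp add: component_def)
  thus "w \<in> X" by induction (use assms in auto)
qed

lemma comp_subset_V: "u \<in> V \<Longrightarrow> component S u \<subseteq> V"
  by (rule comp_least) (auto dest: nbrsD)

lemma comp_disjoint: "u \<notin> S \<Longrightarrow> component S u \<inter> S = {}"
  using comp_least[of u "- S" S] by auto

lemma comp_trans: "w \<in> component S u \<Longrightarrow> component S w \<subseteq> component S u"
  by (rule comp_least) (auto intro: comp_step)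

lemma comp_sym:
  assumes "u \<notin> S" "w \<in> component S u"
  shows "u \<in> component S w"
proof -
  have "component S u \<subseteq> {w. w \<notin> S \<and> u \<in> component S w}"
  proof (rule comp_least)
    fix w z assume w: "w \<in> {w. w \<notin> S \<and> u \<in> component S w}" "z \<in> nbrs w" "z \<notin> S"
    hence "w \<in> component S z" using comp_step[of z S z w] nbrs_sym by auto
    thus "z \<in> {w. w \<notin> S \<and> u \<in> component S w}" using comp_trans w by auto
  qed (use assms in auto)
  thus ?thesis using assms by auto
qed

lemma comp_eq:
  assumes "u \<notin> S" "w \<in> component S u"
  shows "component S w = component S u"
  using comp_trans[OF assms(2)] comp_trans[OF comp_sym[OF assms]] by auto

lemma comp_mono: "T \<subseteq> S \<Longrightarrow> component S u \<subseteq> component T u"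
  by (rule comp_least) (auto intro: comp_step)

text \<open>Apart from vertices of \<open>B\<close>, the old component is covered by the components
  that start at the outer neighbours of \<open>B\<close>. These are finitely many by bounded degree,
  so one of the components is infinite.\<close>

lemma infinite_comp_exit:
  assumes "u \<notin> S" "infinite (component S u)" "finite B" "u \<in> B"
  obtains w z where "w \<in> B" "w \<in> component S u" "z \<in> nbrs w" "z \<notin> S \<union> B"
    "infinite (component (S \<union> B) z)"
proof -
  define Z where "Z = (\<Union>w\<in>B \<inter> component S u. nbrs w - (S \<union> B))"
  have "component S u \<subseteq> (B \<inter> component S u) \<union> (\<Union>z\<in>Z. component (S \<union> B) z)"
  proof (rule comp_least)
    fix w z
    assume w: "w \<in> (B \<inter> component S u) \<union> (\<Union>z\<in>Z. component (S \<union> B) z)" and z: "z \<in> nbrs w" "z \<notin> S"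
    have sub: "component (S \<union> B) y \<subseteq> component S u" if "y \<in> Z" for y
    proof -
      have "y \<in> component S u" using that by (auto simp: Z_def intro: comp_step)
      thus ?thesis using comp_trans[of y S u] comp_mono[of S "S \<union> B" y] by auto
    qed
    have "w \<in> component S u" using w sub by auto
    hence "z \<in> component S u" using z comp_step by auto
    moreover have "z \<in> (\<Union>z\<in>Z. component (S \<union> B) z)" if "z \<notin> B"
    proof (cases "w \<in> B")
      case True
      hence "z \<in> Z" using \<open>w \<in> component S u\<close> z that by (auto simp: Z_def)
      thus ?thesis using comp_refl by blast
    next
      case False
      then obtain y where "y \<in> Z" "w \<in> component (S \<union> B) y" using w by auto
      thus ?thesis using comp_step[of w "S \<union> B" y z] z that by auto
    qed
    ultimately show "z \<in> (B \<inter> component S u) \<union> (\<Union>z\<in>Z. component (S \<union> B) z)" by auto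
  qed (use assms in auto)
  moreover have "finite Z" using assms by (auto simp: Z_def)
  ultimately have "\<exists>z\<in>Z. infinite (component (S \<union> B) z)"
    using assms(2,3) by (meson finite_Int finite_UN finite_Un finite_subset)
  thus ?thesis using that by (auto simp: Z_def)
qed

end

locale cubic_girth4 = cubic_graph +
  assumes infinite_V: "infinite V" and connected: "connected_graph V E"
    and transitive: "vertex_transitive V E" and girth4: "girth V E = 4"
begin

lemma closed_eq_V:
  assumes "X \<subseteq> V" "X \<noteq> {}" "\<And>w z. w \<in> X \<Longrightarrow> z \<in> nbrs w \<Longrightarrow> z \<in> X"
  shows "X = V"
proof -
  obtain u where u: "u \<in> X" using assms by auto
  have "hd p \<in> X \<Longrightarrow> walk V E p \<Longrightarrow> last p \<in> X" for p
  proof (induction p)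
    case (Cons a p) thus ?case using assms(3) by (cases "p = []") (auto simp: walk_Cons_iff)
  qed (simp add: walk_def)
  moreover have "\<exists>p. walk V E p \<and> hd p = u \<and> last p = v" if "v \<in> V" for v
    using connected assms(1) u that by (auto simp: connected_graph_def)
  ultimately show ?thesis using assms(1) u by blast
qed

lemma closed_infinite:
  assumes "X \<subseteq> V" "X \<noteq> {}" "\<And>w z. w \<in> X \<Longrightarrow> z \<in> nbrs w \<Longrightarrow> z \<in> X"
  shows "infinite X"
  using closed_eq_V[OF assms] infinite_V by simp

lemma comp_empty: "u \<in> V \<Longrightarrow> component {} u = V"
proof (rule closed_eq_V[OF comp_subset_V])
  show "component {} u \<noteq> {}" using comp_refl[of u "{}"] by blast
qed (auto intro: comp_step)

section \<open>Automorphisms, and existence of the connective constant\<close>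

lemma automorphism_nbrs:
  assumes "automorphism V E f" "u \<in> V"
  shows "nbrs (f u) = f ` nbrs u"
proof -
  have bij: "bij_betw f V V" and e: "\<And>u v. u \<in> V \<Longrightarrow> v \<in> V \<Longrightarrow> {f u, f v} \<in> E \<longleftrightarrow> {u, v} \<in> E"
    using assms by (auto simp: automorphism_def)
  show ?thesis
  proof (intro equalityI subsetI)
    fix w assume w: "w \<in> nbrs (f u)"
    then obtain z where z: "z \<in> V" "w = f z" using bij nbrsD by (metis bij_betw_imp_surj_on imageE)
    thus "w \<in> f ` nbrs u" using e[of u z] w assms by (auto simp: nbrs_def)
  qed (use e assms nbrsD in \<open>auto simp: nbrs_def\<close>)
qed

lemma automorphism_obtain:
  assumes "u \<in> V" "v \<in> V"
  obtains f where "automorphism V E f" "f u = v" "inj_on f V" "f ` V = V"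
proof -
  obtain f where "automorphism V E f" "f u = v"
    using assms transitive unfolding vertex_transitive_def by blast
  thus ?thesis using that by (auto simp: automorphism_def bij_betw_def)
qed

lemma comp_automorphism:
  assumes f: "automorphism V E f" and "S \<subseteq> V" "u \<in> V"
  shows "component (f ` S) (f u) \<subseteq> f ` component S u"
proof (rule comp_least)
  fix w z assume w: "w \<in> f ` component S u" "z \<in> nbrs w" "z \<notin> f ` S"
  then obtain w' where w': "w' \<in> component S u" "w = f w'" by auto
  hence "w' \<in> V" using comp_subset_V assms by auto
  then obtain z' where "z' \<in> nbrs w'" "z = f z'" using w w' automorphism_nbrs[OF f] by auto
  moreover have "z' \<notin> S" using calculation w by auto
  ultimately show "z \<in> f ` component S u" using w' comp_step by blast
qed auto

lemma num_saws_le: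
  assumes "u \<in> V" "v \<in> V"
  shows "num_saws V E n u \<le> num_saws V E n v"
proof -
  obtain f where f: "automorphism V E f" "f u = v" "inj_on f V" "f ` V = V"
    using automorphism_obtain assms by blast
  have w: "walk V E (map f p)" if "walk V E p" for p
    using that
  proof (induction p)
    case (Cons a p)
    thus ?case using f automorphism_nbrs[OF f(1)]
      by (auto simp: walk_Cons_iff hd_map)
  qed (simp add: walk_def)
  have "map f ` saws V E n u \<subseteq> saws V E n v"
  proof
    fix q assume "q \<in> map f ` saws V E n u"
    then obtain p where p: "q = map f p" "p \<in> saws V E n u" by auto
    moreover have "set p \<subseteq> V" "p \<noteq> []" using p by (auto simp: saws_def walk_def)
    ultimately show "q \<in> saws V E n v"
      using w f by (auto simp: saws_def hd_map distinct_map intro: inj_on_subset)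
  qed
  moreover have "inj_on (map f) (saws V E n u)"
  proof (rule inj_onI)
    fix p q assume pq: "p \<in> saws V E n u" "q \<in> saws V E n u" "map f p = map f q"
    hence "set p \<union> set q \<subseteq> V" by (auto simp: saws_def walk_def)
    thus "p = q" using pq(3) f(3) by (meson inj_on_map_eq_map inj_on_subset)
  qed
  ultimately show ?thesis
    unfolding num_saws_def using card_inj_on_le finite_saws by blast
qed

lemma num_saws_eq: "u \<in> V \<Longrightarrow> v \<in> V \<Longrightarrow> num_saws V E n u = num_saws V E n v"
  by (intro antisym num_saws_le)

text \<open>A walk is cut at its vertex number \<open>m\<close>; the second piece starts at the end
  of the first, and by transitivity the number of its continuations does not depend on that
  vertex.\<close>

lemma num_saws_add:
  assumes "v \<in> V"
  shows "num_saws V E (m + n) v \<le> num_saws V E m v * num_saws V E n v"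
proof -
  define X where "X = (SIGMA p:saws V E m v. saws V E n (last p))"
  \<comment> \<open>The two pieces share the vertex at position \<open>m\<close>, hence
    \<open>Suc m\<close> in one and \<open>m\<close> in the other.\<close>
  define h where "h = (\<lambda>p :: 'a list. (take (Suc m) p, drop m p))"
  have "inj_on h (saws V E (m + n) v)"
  proof (rule inj_onI)
    fix p q assume "p \<in> saws V E (m + n) v" "q \<in> saws V E (m + n) v" and h: "h p = h q"
    have "take m (take (Suc m) r) = take m r" for r :: "'a list" by (simp add: take_take)
    hence "take m p = take m q" "drop m p = drop m q" using h unfolding h_def by (metis prod.inject)+
    thus "p = q" by (metis append_take_drop_id)
  qed
  moreover have "h ` saws V E (m + n) v \<subseteq> X"
  proof
    fix z assume "z \<in> h ` saws V E (m + n) v"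
    then obtain p where p: "p \<in> saws V E (m + n) v" "z = h p" by auto
    have len: "length p = Suc (m + n)" and wp: "walk V E p" and d: "distinct p" and hv: "hd p = v"
      using p by (auto simp: saws_def)
    have s: "set (take (Suc m) p) \<subseteq> V" "set (drop m p) \<subseteq> V"
      using wp by (auto simp: walk_def dest: in_set_takeD in_set_dropD)
    have "successively (\<lambda>u v. {u, v} \<in> E) (take (Suc m) p @ drop (Suc m) p)"
      "successively (\<lambda>u v. {u, v} \<in> E) (take m p @ drop m p)"
      using wp by (auto simp: walk_def)
    hence "walk V E (take (Suc m) p)" "walk V E (drop m p)"
      using len s unfolding successively_append_iff by (auto simp: walk_def)
    moreover have "last (take (Suc m) p) = hd (drop m p)"
      using len by (simp add: take_Suc_conv_app_nth hd_drop_conv_nth)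
    ultimately show "z \<in> X" using len d hv p
      by (auto simp: X_def h_def saws_def)
  qed
  moreover have "finite X" by (auto simp: X_def finite_saws)
  ultimately have "num_saws V E (m + n) v \<le> card X"
    unfolding num_saws_def using card_inj_on_le by blast
  also have "card X = (\<Sum>p\<in>saws V E m v. num_saws V E n (last p))"
    by (simp add: X_def num_saws_def finite_saws)
  also have "\<dots> = (\<Sum>p\<in>saws V E m v. num_saws V E n v)"
  proof (intro sum.cong refl num_saws_eq assms)
    fix p assume "p \<in> saws V E m v"
    thus "last p \<in> V" by (auto simp: saws_def walk_def)
  qed
  finally show ?thesis by (simp add: num_saws_def)
qed

lemma connective_constant_limit:
  assumes "v \<in> V"
  shows "(\<lambda>n. root n (real (num_saws V E n v))) \<longlonglongrightarrow> connective_constant V E"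
proof -
  obtain L where L: "(\<lambda>n. root n (real (num_saws V E n v))) \<longlonglongrightarrow> L"
  proof (rule fekete_root[of "\<lambda>n. real (num_saws V E n v)"])
    show "real (num_saws V E (m + n) v) \<le> real (num_saws V E m v) * real (num_saws V E n v)" for m n
      using num_saws_add[OF assms, of m n] by (metis of_nat_le_iff of_nat_mult)
  qed auto
  have all: "\<forall>u\<in>V. (\<lambda>n. root n (real (num_saws V E n u))) \<longlonglongrightarrow> L"
  proof
    fix u assume "u \<in> V"
    hence "(\<lambda>n. root n (real (num_saws V E n u))) = (\<lambda>n. root n (real (num_saws V E n v)))"
      using num_saws_eq[OF _ assms] by presburger
    thus "(\<lambda>n. root n (real (num_saws V E n u))) \<longlonglongrightarrow> L" using L by presburger
  qed
  have "connective_constant V E = L"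
    unfolding connective_constant_def
  proof (rule the_equality)
    show "\<forall>u\<in>V. (\<lambda>n. root n (real (num_saws V E n u))) \<longlonglongrightarrow> L" by (rule all)
    fix M assume "\<forall>u\<in>V. (\<lambda>n. root n (real (num_saws V E n u))) \<longlonglongrightarrow> M"
    hence "(\<lambda>n. root n (real (num_saws V E n v))) \<longlonglongrightarrow> M" using assms by (rule bspec)
    thus "M = L" using L by (rule LIMSEQ_unique)
  qed
  thus ?thesis using L by simp
qed

section \<open>Girth four: no triangles, and a square at every vertex\<close>

lemma cycle_length_ge: "cycle V E c \<Longrightarrow> length c \<ge> 4"
proof -
  assume "cycle V E c"
  hence "girth V E \<le> enat (length c)" by (auto simp: girth_def intro: INF_lower)
  hence "enat 4 \<le> enat (length c)" using girth4 by (simp add: numeral_eq_enat)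
  thus ?thesis by simp
qed

lemma no_triangle:
  assumes "a \<in> nbrs u" "b \<in> nbrs u"
  shows "a \<notin> nbrs b"
proof
  assume "a \<in> nbrs b"
  hence "{u, a} \<in> E" "{a, b} \<in> E" "{b, u} \<in> E"
    using assms nbrs_sym by (simp_all add: nbrs_def)
  moreover have "u \<in> V" "a \<in> V" "b \<in> V" "u \<noteq> a" "u \<noteq> b" "a \<noteq> b"
    using assms nbrsD \<open>a \<in> nbrs b\<close> by metis+
  ultimately have "cycle V E [u, a, b]"
    by (simp add: cycle_def walk_def)
  thus False using cycle_length_ge[of "[u, a, b]"] by simp
qed

definition square :: "'a \<Rightarrow> 'a \<Rightarrow> 'a \<Rightarrow> 'a \<Rightarrow> bool" where
  "square v a w b \<longleftrightarrow> a \<in> nbrs v \<and> w \<in> nbrs a \<and> b \<in> nbrs w \<and> v \<in> nbrs b \<and> v \<noteq> w \<and> a \<noteq> b"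

lemma square_rotate: "square v a w b \<Longrightarrow> square a w b v"
  by (auto simp: square_def)

lemma square_automorphism:
  assumes f: "automorphism V E f" and s: "square v a w b"
  shows "square (f v) (f a) (f w) (f b)"
proof -
  have V: "v \<in> V" "a \<in> V" "w \<in> V" "b \<in> V" using s nbrsD by (auto simp: square_def)
  moreover have "inj_on f V" using f by (auto simp: automorphism_def bij_betw_def)
  ultimately show ?thesis
    using s automorphism_nbrs[OF f] by (auto simp: square_def dest: inj_onD)
qed

lemma ex_square:
  assumes "v \<in> V"
  obtains a w b where "square v a w b"
proof -
  \<comment> \<open>The infimum is attained: the value 4 rules out the empty set, whose infimum is
    infinite, and over a nonempty set the infimum in \<open>enat\<close> is a least element. The
    resulting 4-cycle is then carried to \<open>v\<close> by an automorphism.\<close>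
  have "girth V E \<in> (\<lambda>c. enat (length c)) ` {c. cycle V E c}"
  proof (cases "{c. cycle V E c} = {}")
    case True
    hence "girth V E = \<infinity>" by (simp add: girth_def top_enat_def)
    thus ?thesis using girth4 by simp
  next
    case False
    then obtain e where "e \<in> (\<lambda>c. enat (length c)) ` {c. cycle V E c}" by blast
    hence "(LEAST e. e \<in> (\<lambda>c. enat (length c)) ` {c. cycle V E c})
             \<in> (\<lambda>c. enat (length c)) ` {c. cycle V E c}"
      by (rule LeastI)
    thus ?thesis unfolding girth_def Inf_enat_def using False by simp
  qed
  then obtain c where c: "cycle V E c" "length c = 4"
    using girth4 by (auto simp: numeral_eq_enat)
  then obtain x a w b where "c = [x, a, w, b]" by (force simp: length_Suc_conv numeral_eq_Suc)
  hence sq: "square x a w b"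
    using c by (simp add: cycle_def walk_def square_def nbrs_def)
  hence "x \<in> V" using nbrsD by (auto simp: square_def)
  then obtain f where "automorphism V E f" "f x = v" using automorphism_obtain assms by metis
  thus ?thesis using square_automorphism[OF _ sq] that by metis
qed

lemma nbrs_eqI:
  assumes "a \<in> nbrs v" "b \<in> nbrs v" "c \<in> nbrs v" "a \<noteq> b" "a \<noteq> c" "b \<noteq> c"
  shows "nbrs v = {a, b, c}"
proof -
  have "card {a, b, c} = card (nbrs v)" using assms card_nbrs[of v] nbrsD by auto
  thus ?thesis using assms card_subset_eq[of "nbrs v" "{a, b, c}"] by auto
qed

lemma nbrs_third:
  assumes "a \<in> nbrs v" "b \<in> nbrs v" "a \<noteq> b"
  obtains c where "nbrs v = {a, b, c}" "c \<noteq> a" "c \<noteq> b"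
proof -
  have "card (nbrs v - {a, b}) = 1"
    using assms card_nbrs[of v] nbrsD by (subst card_Diff_subset) auto
  then obtain c where "nbrs v - {a, b} = {c}" by (auto simp: card_1_singleton_iff)
  thus ?thesis using that[of c] assms by auto
qed

end

section \<open>Graphs with one square at each vertex\<close>

locale unique_square = cubic_girth4 +
  assumes unique_square:
    "square v a w b \<Longrightarrow> square v a' w' b' \<Longrightarrow> {v, a, w, b} = {v, a', w', b'}"
begin

text \<open>Collecting all squares at \<open>v\<close> avoids choosing one;
  \<open>unique_square\<close> makes the union a single square. Inserting \<open>v\<close> makes
  \<open>block_refl\<close> hold without an assumption on \<open>v\<close>.\<close>

definition block :: "'a \<Rightarrow> 'a set" where
  "block v = insert v {y. \<exists>a w b. square v a w b \<and> y \<in> {a, w, b}}"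

definition mate :: "'a \<Rightarrow> 'a" where
  "mate v = (THE z. z \<in> nbrs v \<and> z \<notin> block v)"

lemma block_square: "square v a w b \<Longrightarrow> block v = {v, a, w, b}"
  using unique_square[of v a w b] unfolding block_def by blast

lemma square_props:
  assumes "square v a w b"
  shows "distinct [v, a, w, b]" "{v, a, w, b} \<subseteq> V"
    "block v = {v, a, w, b}" "block a = {v, a, w, b}" "block w = {v, a, w, b}" "block b = {v, a, w, b}"
    "nbrs v = {a, b, mate v}" "mate v \<notin> {v, a, w, b}"
proof -
  have n: "a \<in> nbrs v" "w \<in> nbrs a" "b \<in> nbrs w" "v \<in> nbrs b" "b \<in> nbrs v" "v \<noteq> w" "a \<noteq> b"
    using assms nbrs_sym by (auto simp: square_def)
  show "distinct [v, a, w, b]" "{v, a, w, b} \<subseteq> V" using n nbrsD by auto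
  have s: "square a w b v" "square w b v a" "square b v a w" using assms square_rotate by blast+
  show b: "block v = {v, a, w, b}" by (rule block_square[OF assms])
  show "block a = {v, a, w, b}" "block w = {v, a, w, b}" "block b = {v, a, w, b}"
    using s block_square by auto
  obtain c where c: "nbrs v = {a, b, c}" "c \<noteq> a" "c \<noteq> b"
    using nbrs_third[OF n(1) n(5) n(7)] by blast
  \<comment> \<open>A diagonal of the square would close a triangle, so the third neighbour of
    \<open>v\<close> lies outside the square.\<close>
  have "w \<notin> nbrs v" using no_triangle[of v a w] n nbrs_sym by blast
  hence cb: "c \<notin> block v" using c b nbrsD(3)[of c v] by auto
  have "mate v = c" unfolding mate_def
    by (rule the_equality) (use b c cb in auto)
  thus "nbrs v = {a, b, mate v}" "mate v \<notin> {v, a, w, b}" using c cb b by auto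
qed

lemma block_cases:
  assumes "v \<in> V"
  obtains a w b where "square v a w b" "block v = {v, a, w, b}" "distinct [v, a, w, b]"
    "nbrs v = {a, b, mate v}" "mate v \<notin> {v, a, w, b}"
proof -
  obtain a w b where s: "square v a w b" using ex_square assms by blast
  show ?thesis by (rule that[OF s square_props(3)[OF s] square_props(1)[OF s] square_props(7,8)[OF s]])
qed

lemma block_refl [simp]: "v \<in> block v"
  by (simp add: block_def)

lemma block_eq:
  assumes "v \<in> V" "u \<in> block v"
  shows "block u = block v"
proof -
  obtain a w b where "square v a w b" using ex_square assms by blast
  from square_props(3-6)[OF this] assms(2) show ?thesis by auto
qed

lemma block_subset_V:
  assumes "v \<in> V"
  shows "block v \<subseteq> V"
proof -
  obtain a w b where "square v a w b" using ex_square assms by blast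
  from square_props(2,3)[OF this] show ?thesis by simp
qed

lemma card_block: "v \<in> V \<Longrightarrow> card (block v) = 4"
  by (erule block_cases) auto

lemma finite_block: "v \<in> V \<Longrightarrow> finite (block v)"
  by (erule block_cases) auto

lemma mate_nbrs: "v \<in> V \<Longrightarrow> mate v \<in> nbrs v"
  by (erule block_cases) auto

lemma mate_V: "v \<in> V \<Longrightarrow> mate v \<in> V"
  using mate_nbrs nbrsD by blast

lemma mate_notin_block: "v \<in> V \<Longrightarrow> mate v \<notin> block v"
  by (erule block_cases) auto

lemma nbrs_cases: "v \<in> V \<Longrightarrow> z \<in> nbrs v \<Longrightarrow> z \<in> block v \<or> z = mate v"
  by (erule block_cases) auto

lemma mate_mate [simp]:
  assumes "v \<in> V"
  shows "mate (mate v) = v"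
proof -
  have "v \<in> nbrs (mate v)" using mate_nbrs[OF assms] nbrs_sym by auto
  moreover have "v \<notin> block (mate v)"
    using block_eq[OF mate_V[OF assms], of v] mate_notin_block[OF assms] block_refl by metis
  ultimately show ?thesis using nbrs_cases[OF mate_V[OF assms]] by metis
qed

lemma mate_neq: "v \<in> V \<Longrightarrow> mate v \<noteq> v"
  using mate_notin_block block_refl by metis

lemma block_automorphism:
  assumes f: "automorphism V E f" and "v \<in> V"
  shows "block (f v) = f ` block v"
proof -
  obtain a w b where s: "square v a w b" using ex_square assms by blast
  show ?thesis
    using square_props(3)[OF s] square_props(3)[OF square_automorphism[OF f s]] by auto
qed

section \<open>Unions of squares, parity, and components of the complement\<close>

definition blocky :: "'a set \<Rightarrow> bool" where
  "blocky S \<longleftrightarrow> S \<subseteq> V \<and> (\<forall>z\<in>S. block z \<subseteq> S)"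

lemma blocky_block: "v \<in> V \<Longrightarrow> blocky (block v)"
  unfolding blocky_def by (metis block_eq block_subset_V subset_refl)

lemma blocky_Un: "blocky S \<Longrightarrow> blocky T \<Longrightarrow> blocky (S \<union> T)"
  by (auto simp: blocky_def)

lemma blocky_disjoint:
  assumes "blocky S" "u \<in> V" "u \<notin> S"
  shows "block u \<inter> S = {}"
proof -
  have "u \<in> S" if "z \<in> block u" "z \<in> S" for z
  proof -
    have "u \<in> block z" using block_eq[OF assms(2) that(1)] by simp
    thus ?thesis using that assms by (auto simp: blocky_def)
  qed
  thus ?thesis using assms by blast
qed

text \<open>A square with a corner outside \<open>S\<close> misses \<open>S\<close> altogether, so
  its other corners can be reached along its own edges.\<close>

lemma blocky_comp:
  assumes "blocky S" "u \<in> V" "u \<notin> S"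
  shows "blocky (component S u)"
  unfolding blocky_def
proof (intro conjI ballI subsetI)
  show "\<And>z. z \<in> component S u \<Longrightarrow> z \<in> V" using comp_subset_V assms by blast
  fix z y assume z: "z \<in> component S u" and y: "y \<in> block z"
  have zV: "z \<in> V" "z \<notin> S" using z comp_subset_V comp_disjoint assms by blast+
  obtain a w b where sq: "square z a w b" "block z = {z, a, w, b}" using block_cases[OF zV(1)] by metis
  have "{a, w, b} \<inter> S = {}" using blocky_disjoint[OF assms(1) zV] sq by auto
  hence out: "a \<notin> S" "b \<notin> S" "w \<notin> S" by auto
  have n: "a \<in> nbrs z" "b \<in> nbrs z" "w \<in> nbrs a"
    using sq(1) nbrs_sym[of z b] by (auto simp: square_def)
  have "a \<in> component S u" "b \<in> component S u" using comp_step[OF z] n out by auto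
  moreover have "w \<in> component S u" using comp_step[OF calculation(1)] n out by auto
  ultimately have "a \<in> component S u" "b \<in> component S u" "w \<in> component S u" by auto
  thus "y \<in> component S u" using y z sq by auto
qed

lemma even_card_blocky:
  assumes "blocky D" "finite D"
  shows "even (card D)"
proof -
  have D: "D = \<Union>(block ` D)" using assms by (force simp: blocky_def)
  have "2 dvd card (\<Union>(block ` D))"
  proof (rule dvd_partition)
    show "finite (\<Union>(block ` D))" using D assms by simp
    show "\<forall>c\<in>block ` D. 2 dvd card c" using assms card_block by (auto simp: blocky_def)
    show "\<forall>c1\<in>block ` D. \<forall>c2\<in>block ` D. c1 \<noteq> c2 \<longrightarrow> c1 \<inter> c2 = {}"
    proof (intro ballI impI)
      fix c1 c2 assume c: "c1 \<in> block ` D" "c2 \<in> block ` D" "c1 \<noteq> c2"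
      then obtain x y where "x \<in> V" "y \<in> V" "c1 = block x" "c2 = block y"
        using assms by (auto simp: blocky_def)
      thus "c1 \<inter> c2 = {}" using c(3) block_eq[of x] block_eq[of y] by (metis disjoint_iff)
    qed
  qed
  thus ?thesis using D by simp
qed

lemma even_card_mates:
  assumes "X \<subseteq> V" "finite X" "\<And>z. z \<in> X \<Longrightarrow> mate z \<in> X"
  shows "even (card X)"
proof -
  have X: "X = \<Union>((\<lambda>z. {z, mate z}) ` X)" using assms by auto
  have "2 dvd card (\<Union>((\<lambda>z. {z, mate z}) ` X))"
  proof (rule dvd_partition)
    show "finite (\<Union>((\<lambda>z. {z, mate z}) ` X))" using X assms by simp
    show "\<forall>c\<in>(\<lambda>z. {z, mate z}) ` X. 2 dvd card c"
    proof
      fix c assume "c \<in> (\<lambda>z. {z, mate z}) ` X"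
      then obtain z where "z \<in> V" "c = {z, mate z}" using assms by auto
      thus "2 dvd card c" using mate_neq[of z] by (metis card_2_iff dvd_refl)
    qed
    show "\<forall>c1\<in>(\<lambda>z. {z, mate z}) ` X. \<forall>c2\<in>(\<lambda>z. {z, mate z}) ` X. c1 \<noteq> c2 \<longrightarrow> c1 \<inter> c2 = {}"
    proof (intro ballI impI)
      fix c1 c2 assume c: "c1 \<in> (\<lambda>z. {z, mate z}) ` X" "c2 \<in> (\<lambda>z. {z, mate z}) ` X" "c1 \<noteq> c2"
      then obtain x y where "x \<in> V" "y \<in> V" "c1 = {x, mate x}" "c2 = {y, mate y}"
        using assms by auto
      show "c1 \<inter> c2 = {}"
      proof (rule ccontr)
        assume "c1 \<inter> c2 \<noteq> {}"
        then obtain t where t: "t \<in> c1" "t \<in> c2" by blast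
        have "c1 = {t, mate t}"
          using t(1) mate_mate[OF \<open>x \<in> V\<close>] unfolding \<open>c1 = {x, mate x}\<close> by auto
        moreover have "c2 = {t, mate t}"
          using t(2) mate_mate[OF \<open>y \<in> V\<close>] unfolding \<open>c2 = {y, mate y}\<close> by auto
        ultimately show False using c(3) by simp
      qed
    qed
  qed
  thus ?thesis using X by simp
qed

text \<open>The handshake argument in the contracted graph: \<open>D\<close> consists of 4-element
  squares, and its vertices whose mates stay in \<open>D\<close> pair up, so evenly many
  remain.\<close>

lemma even_card_boundary:
  assumes "blocky D" "finite D"
  shows "even (card {z \<in> D. mate z \<notin> D})"
proof -
  have "even (card {z \<in> D. mate z \<in> D})"
    using assms mate_mate by (intro even_card_mates) (auto simp: blocky_def subset_iff)
  moreover have "card D = card {z \<in> D. mate z \<in> D} + card {z \<in> D. mate z \<notin> D}"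
    using assms(2) by (subst card_Un_disjoint[symmetric]) (auto intro: arg_cong[where f = card])
  ultimately show ?thesis using even_card_blocky[OF assms] by auto
qed

text \<open>A component not joined to the deleted square would be closed under all neighbours, and
  by connectedness would be the whole graph.\<close>

lemma comp_block_hits:
  assumes x: "x \<in> V" and v: "v \<in> V" "v \<notin> block x"
  shows "\<exists>y\<in>component (block x) v. mate y \<in> block x"
proof (rule ccontr)
  assume no: "\<not> (\<exists>y\<in>component (block x) v. mate y \<in> block x)"
  have bl: "blocky (component (block x) v)" using blocky_comp blocky_block v x by simp
  have "component (block x) v = V"
  proof (rule closed_eq_V)
    show "component (block x) v \<subseteq> V" using comp_subset_V v by simp
    show "component (block x) v \<noteq> {}" using comp_refl by blast
    fix w y assume w: "w \<in> component (block x) v" "y \<in> nbrs w"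
    hence "w \<in> V" using bl by (auto simp: blocky_def)
    hence "y \<in> block w \<or> y = mate w" using nbrs_cases w by blast
    thus "y \<in> component (block x) v"
    proof
      assume "y \<in> block w" thus ?thesis using w bl by (auto simp: blocky_def)
    next
      assume "y = mate w" thus ?thesis using w no comp_step by blast
    qed
  qed
  thus False using comp_disjoint[of v "block x"] v x block_refl by blast
qed

text \<open>
  A smallest finite component of the complement of a block contains a block, and moving it to
  that block by an automorphism yields either a smaller one or, together with the original
  component, a finite cover of the graph.
\<close>

lemma infinite_comp_block:
  assumes "x \<in> V" "z \<in> V" "z \<notin> block x"
  shows "infinite (component (block x) z)"
proof (rule ccontr)
  define bad where "bad = (\<lambda>(x, z). x \<in> V \<and> z \<in> V \<and> z \<notin> block x \<and> finite (component (block x) z))"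
  assume "\<not> infinite (component (block x) z)"
  hence "bad (x, z)" using assms by (simp add: bad_def)
  then obtain xz where m: "bad xz"
    "\<And>xz'. bad xz' \<Longrightarrow> card (component (block (fst xz)) (snd xz)) \<le> card (component (block (fst xz')) (snd xz'))"
    using exists_least_iff[of "\<lambda>n. \<exists>xz. bad xz \<and> card (component (block (fst xz)) (snd xz)) = n"]
    by (metis not_le)
  obtain x z where xz: "xz = (x, z)" by (cases xz)
  define B where "B = block x"
  define C where "C = component B z"
  have V: "x \<in> V" "z \<in> V" "z \<notin> B" "finite C" using m xz by (auto simp: bad_def B_def C_def)
  have min: "card C \<le> card (component (block x') z')"
    if "x' \<in> V" "z' \<in> V" "z' \<notin> block x'" "finite (component (block x') z')" for x' z'
    using m(2)[of "(x', z')"] that xz by (simp add: bad_def B_def C_def)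
  have C_V: "C \<subseteq> V" and C_B: "C \<inter> B = {}"
    using comp_subset_V comp_disjoint V by (auto simp: C_def)
  obtain y where y: "y \<in> C" "mate y \<in> B" using comp_block_hits[of x z] V by (auto simp: C_def B_def)
  have yV: "y \<in> V" using y C_V by auto
  define B' where "B' = block y"
  have "blocky C" using blocky_comp blocky_block V by (simp add: C_def B_def)
  hence B'C: "B' \<subseteq> C" using y by (auto simp: blocky_def B'_def)
  obtain f where f: "automorphism V E f" "f x = y" "inj_on f V" "f ` V = V"
    using automorphism_obtain V yV by blast
  have fB: "f ` B = B'" using block_automorphism[OF f(1) V(1)] f by (simp add: B_def B'_def)
  define C' where "C' = component B' (f z)"
  have C'sub: "C' \<subseteq> f ` C" unfolding C'_def C_def fB[symmetric]
    using comp_automorphism[OF f(1)] V block_subset_V by (simp add: B_def)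
  hence fin: "finite C'" using V finite_subset by blast
  have card': "card C' \<le> card C"
    using C'sub V(4) by (meson card_image_le card_mono finite_imageI le_trans)
  have fz: "f z \<in> V" "f z \<notin> B'"
    using f V fB block_subset_V[of x] by (auto simp: B_def dest!: inj_onD)
  have bl': "blocky C'" using blocky_comp blocky_block fz yV by (simp add: C'_def B'_def)
  have C'B': "C' \<inter> B' = {}" using comp_disjoint fz by (simp add: C'_def)
  obtain y' where y': "y' \<in> C'" "mate y' \<in> B'"
    using comp_block_hits[of y "f z"] yV fz by (auto simp: C'_def B'_def)
  show False
  proof (cases "C' \<inter> B = {}")
    \<comment> \<open>Here \<open>C'\<close> is attached to \<open>B'\<close>, which lies inside
      \<open>C\<close>, and never meets \<open>B\<close>, so it cannot leave \<open>C\<close>. It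
      also misses \<open>y\<close>, hence it is strictly smaller than the minimal
      \<open>C\<close>.\<close>
    case True
    have y'V: "y' \<in> V" using y' bl' by (auto simp: blocky_def)
    have "y' \<in> nbrs (mate y')" using mate_nbrs[OF y'V] nbrs_sym by blast
    hence "y' \<in> C" using comp_step[of "mate y'" B z y'] y' True B'C by (auto simp: C_def)
    have "C' = component B' y'" using comp_eq[of "f z" B' y'] fz y' by (simp add: C'_def)
    moreover have "component B' y' \<subseteq> C \<inter> C'"
    proof (rule comp_least)
      fix w t assume t: "w \<in> C \<inter> C'" "t \<in> nbrs w" "t \<notin> B'"
      hence "t \<in> C'" using comp_step by (auto simp: C'_def)
      thus "t \<in> C \<inter> C'" using t True comp_step[of w B z t] by (auto simp: C_def)
    qed (use \<open>y' \<in> C\<close> y' in auto)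
    moreover have "y \<in> C - C'" using y C'B' by (auto simp: B'_def)
    ultimately have "card C' < card C" using V(4) by (intro psubset_card_mono) auto
    thus False using min[of y "f z"] yV fz fin by (simp add: C'_def B'_def)
  next
    \<comment> \<open>Here \<open>C'\<close> swallows \<open>B\<close>. Any component of the
      complement of \<open>B\<close> other than \<open>C\<close> avoids \<open>B'\<close> and
      touches \<open>B\<close>, so it is swallowed too, and the finite sets \<open>C\<close> and
      \<open>C'\<close> cover the graph.\<close>
    case False
    then obtain b where b: "b \<in> C'" "b \<in> B" by auto
    hence "B \<subseteq> C'" using bl' block_eq[of x b] V by (auto simp: blocky_def B_def)
    have "V \<subseteq> C \<union> C'"
    proof
      fix v assume v: "v \<in> V"
      show "v \<in> C \<union> C'"
      proof (cases "v \<in> C \<or> v \<in> B")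
        case True thus ?thesis using \<open>B \<subseteq> C'\<close> by auto
      next
        case False
        then obtain t where t: "t \<in> component B v" "mate t \<in> B"
          using comp_block_hits[of x v] v V by (auto simp: B_def)
        have dis: "component B v \<inter> C = {}"
        proof (rule ccontr)
          assume "component B v \<inter> C \<noteq> {}"
          then obtain s where s: "s \<in> component B v" "s \<in> C" by auto
          have "component B v = C"
            using comp_eq[of v B s] comp_eq[of z B s] s False V by (simp add: C_def)
          thus False using False comp_refl by blast
        qed
        have tV: "t \<in> V" using t comp_subset_V v by blast
        have "t \<in> nbrs (mate t)" using mate_nbrs[OF tV] nbrs_sym by blast
        hence tC': "t \<in> C'"
          using comp_step[of "mate t" B' "f z" t] t dis B'C \<open>B \<subseteq> C'\<close> by (auto simp: C'_def)
        have "component B t \<subseteq> component B v \<inter> C'"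
        proof (rule comp_least)
          fix w s assume s: "w \<in> component B v \<inter> C'" "s \<in> nbrs w" "s \<notin> B"
          hence "s \<in> component B v" using comp_step by auto
          moreover have "s \<notin> B'" using calculation dis B'C by auto
          ultimately show "s \<in> component B v \<inter> C'" using s comp_step[of w B' "f z" s] by (auto simp: C'_def)
        qed (use t tC' in auto)
        moreover have "component B t = component B v" using comp_eq[of v B t] t False by simp
        ultimately show ?thesis using comp_refl[of v B] by auto
      qed
    qed
    thus False using V(4) fin infinite_V finite_subset by blast
  qed
qed

section \<open>Blocked exits charged to pending edges\<close>

lemma finite_mate_in: "finite S \<Longrightarrow> X \<subseteq> V \<Longrightarrow> finite {w \<in> X. mate w \<in> S}"
  by (rule finite_subset[of _ "mate ` S"]) (force intro: image_eqI[of _ _ "mate _"])+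

text \<open>
  The walk has visited the blocks in \<open>S\<close> and has just entered a new block at \<open>u\<close>. The corners in
  \<open>exits\<close> are those from which it can go on forever, and \<open>pending\<close> counts the edges from \<open>S\<close> into
  the unvisited component that it has not used.
\<close>

definition state :: "'a set \<Rightarrow> 'a \<Rightarrow> bool" where
  "state S u \<longleftrightarrow> finite S \<and> blocky S \<and> u \<in> V \<and> u \<notin> S \<and> mate u \<in> S \<and> infinite (component S u)"

definition pending :: "'a set \<Rightarrow> 'a \<Rightarrow> nat" where
  "pending S u = card {w \<in> component S u - {u}. mate w \<in> S}"

definition exits :: "'a set \<Rightarrow> 'a \<Rightarrow> 'a set" where
  "exits S u = {w \<in> block u - {u}. mate w \<notin> S \<and> infinite (component (S \<union> block u) (mate w))}"

lemma mate_block: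
  assumes "u \<in> V" "w \<in> block u"
  shows "w \<in> V" "mate w \<notin> block u" "mate w \<in> V"
  using assms block_subset_V block_eq[OF assms] mate_notin_block[of w] mate_V by auto

text \<open>The infinite component must continue past the square through some corner, and not
  through \<open>u\<close>, whose mate is already visited.\<close>

lemma exits_nonempty:
  assumes "state S u"
  shows "exits S u \<noteq> {}"
proof -
  have u: "u \<in> V" "u \<notin> S" "mate u \<in> S" "infinite (component S u)" "finite S"
    using assms by (auto simp: state_def)
  obtain w z where wz: "w \<in> block u" "z \<in> nbrs w" "z \<notin> S \<union> block u" "infinite (component (S \<union> block u) z)"
    by (rule infinite_comp_exit[OF u(2) u(4) finite_block[OF u(1)] block_refl])
  have "z = mate w" using nbrs_cases[of w z] wz mate_block[OF u(1) wz(1)] block_eq[OF u(1) wz(1)] by auto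
  moreover have "w \<noteq> u" using calculation wz u by auto
  ultimately have "w \<in> exits S u" using wz by (auto simp: exits_def)
  thus ?thesis by auto
qed

lemma state_exit:
  assumes "state S u" "g \<in> exits S u"
  shows "state (S \<union> block u) (mate g)"
proof -
  have "u \<in> V" "g \<in> block u" using assms by (auto simp: state_def exits_def)
  thus ?thesis using assms mate_block[of u g] finite_block blocky_Un blocky_block
    by (auto simp: state_def exits_def)
qed

lemma inj_on_mate: "inj_on mate V"
  by (rule inj_on_inverseI[of _ mate]) simp

text \<open>
  Each side edge of the block at \<open>u\<close> that the walk can no longer use is paired with a pending edge
  from \<open>S\<close>. A finite trap cannot be attached to the block at \<open>u\<close> alone, and the number of
  edges leaving it is even, so a trap with two edges to the block has at least two edges to \<open>S\<close>.
\<close>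

lemma pending_exit:
  assumes st: "state S u" and g: "g \<in> exits S u"
  shows "pending (S \<union> block u) (mate g) + 4 \<le> pending S u + 2 * card (exits S u)"
proof -
  define B where "B = block u"
  define S' where "S' = S \<union> B"
  define R where "R = B - {u}"
  \<comment> \<open>The three corners other than \<open>u\<close> split into usable exits,
    \<open>chords\<close> leading back to visited squares, and \<open>traps\<close> leading into
    finite pockets. \<open>D\<close> is the union of the pockets and \<open>T\<close> their points
    of attachment to \<open>S\<close>.\<close>
  define chords where "chords = {w \<in> R. mate w \<in> S}"
  define traps where "traps = {w \<in> R. mate w \<notin> S \<and> finite (component S' (mate w))}"
  define D where "D = (\<Union>w\<in>traps. component S' (mate w))"
  define T where "T = {z \<in> D. mate z \<in> S}"
  define I where "I = component S u"
  define I' where "I' = component S' (mate g)"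
  define X where "X = {w \<in> I - {u}. mate w \<in> S}"
  have u: "u \<in> V" "u \<notin> S" "mate u \<in> S" "infinite I" "finite S" "blocky S" "S \<subseteq> V"
    using st by (auto simp: state_def I_def blocky_def)
  have B: "finite B" "card B = 4" "u \<in> B" "B \<inter> S = {}" "B \<subseteq> V" "blocky B"
    using u finite_block card_block block_refl blocky_disjoint block_subset_V blocky_block
    by (simp_all add: B_def)
  have mB: "mate w \<notin> B" "mate w \<in> V" "w \<in> V" if "w \<in> B" for w
    using mate_block u that by (auto simp: B_def)
  have exits: "exits S u = {w \<in> R. mate w \<notin> S \<and> infinite (component S' (mate w))}"
    by (simp add: exits_def R_def B_def S'_def)
  have S': "blocky S'" using u B blocky_Un by (simp add: S'_def)
  have I_bl: "blocky I" using blocky_comp u by (simp add: I_def)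
  have "u \<in> I" by (simp add: I_def)
  hence BI: "B \<subseteq> I" using I_bl by (auto simp: blocky_def B_def)
  have mI: "component S' (mate w) \<subseteq> I" "mate w \<notin> S'" if "w \<in> R" "mate w \<notin> S" for w
  proof -
    have w: "w \<in> B" "w \<in> I" using that BI by (auto simp: R_def)
    show "mate w \<notin> S'" using mB w that by (auto simp: S'_def)
    have "mate w \<in> I" using comp_step[of w S u "mate w"] w mate_nbrs mB that by (auto simp: I_def)
    thus "component S' (mate w) \<subseteq> I"
      using comp_trans[of "mate w" S u] comp_mono[of S S' "mate w"] by (auto simp: I_def S'_def)
  qed
  have gR: "g \<in> R" "mate g \<notin> S" "infinite I'" using g exits by (auto simp: I'_def)
  have I'S': "I' \<inter> S' = {}" using comp_disjoint mI(2) gR by (simp add: I'_def)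
  have DS': "D \<inter> S' = {}" using comp_disjoint mI(2) by (fastforce simp: D_def traps_def)
  have finR: "finite R" "card R = 3" using B by (auto simp: R_def)
  hence finD: "finite D" by (auto simp: D_def traps_def)
  have comp_D: "component S' (mate w) \<subseteq> D" if "w \<in> traps" for w
    unfolding D_def by (rule UN_upper[OF that])
  have blD: "blocky D"
  proof -
    have "blocky (component S' (mate w))" if "w \<in> traps" for w
      using that blocky_comp[OF S'] mI(2) mB by (auto simp: traps_def R_def)
    thus ?thesis unfolding D_def blocky_def by blast
  qed
  have DV: "D \<subseteq> V" using blD by (simp add: blocky_def)
  have D_fin: "finite (component S' z)" if z: "z \<in> D" for z
  proof -
    obtain w where "w \<in> traps" "z \<in> component S' (mate w)" using z by (auto simp: D_def)
    thus ?thesis using comp_eq[of "mate w" S' z] mI(2) by (auto simp: traps_def)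
  qed
  have D_step: "t \<in> D" if "z \<in> D" "t \<in> nbrs z" "t \<notin> S'" for z t
    using that comp_step by (fastforce simp: D_def)
  have boundary: "{z \<in> D. mate z \<notin> D} = mate ` traps \<union> T"
  proof (intro equalityI subsetI)
    fix z assume z: "z \<in> {z \<in> D. mate z \<notin> D}"
    hence zV: "z \<in> V" using DV by auto
    have "mate z \<in> S'" using D_step[of z "mate z"] z mate_nbrs[OF zV] by auto
    moreover have "z \<in> mate ` traps" if "mate z \<in> B"
    proof -
      have zz: "mate (mate z) = z" using mate_mate zV by auto
      have "z \<notin> S" using z DS' by (auto simp: S'_def)
      hence "mate z \<noteq> u" using zz u(3) by metis
      hence "mate z \<in> traps" using that zz \<open>z \<notin> S\<close> D_fin z by (auto simp: traps_def R_def)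
      thus ?thesis using zz by (metis imageI)
    qed
    ultimately show "z \<in> mate ` traps \<union> T" using z by (auto simp: T_def S'_def)
  next
    fix z assume "z \<in> mate ` traps \<union> T"
    thus "z \<in> {z \<in> D. mate z \<notin> D}"
    proof
      assume "z \<in> mate ` traps"
      then obtain w where w: "w \<in> traps" "z = mate w" by auto
      hence "z \<in> D" using comp_D comp_refl by blast
      moreover have "mate z = w" "w \<in> S'" using w mB by (auto simp: traps_def R_def S'_def)
      ultimately show ?thesis using DS' by auto
    qed (use DS' in \<open>auto simp: T_def S'_def\<close>)
  qed
  have trapsV: "traps \<subseteq> V" using mB by (auto simp: traps_def R_def)
  have "card {z \<in> D. mate z \<notin> D} = card traps + card T"
  proof -
    have "mate ` traps \<inter> T = {}" using mB B by (auto simp: T_def traps_def R_def)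
    moreover have "card (mate ` traps) = card traps"
      using card_image inj_on_mate trapsV inj_on_subset by blast
    moreover have "finite T" "finite traps" using finD finR by (auto simp: T_def traps_def)
    ultimately show ?thesis unfolding boundary by (simp add: card_Un_disjoint)
  qed
  hence parity: "even (card traps + card T)" using even_card_boundary[OF blD finD] by simp
  \<comment> \<open>With no attachment to \<open>S\<close>, the pockets would remain closed after
    deleting the square at \<open>u\<close> alone, giving a finite component that
    \<open>infinite_comp_block\<close> forbids.\<close>
  have T_ne: "T \<noteq> {}" if traps_ne: "traps \<noteq> {}"
  proof
    assume T0: "T = {}"
    obtain w where w: "w \<in> traps" using traps_ne by blast
    have "component B (mate w) \<subseteq> D"
    proof (rule comp_least)
      fix d t assume d: "d \<in> D" "t \<in> nbrs d" "t \<notin> B"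
      show "t \<in> D"
      proof (cases "t \<in> block d")
        case True thus ?thesis using d blD by (auto simp: blocky_def)
      next
        case False
        hence t: "t = mate d" using nbrs_cases[of d t] d DV by auto
        show ?thesis
        proof (rule ccontr)
          assume "t \<notin> D"
          hence "d \<in> mate ` traps" using boundary T0 d t by auto
          thus False using t d mB by (auto simp: traps_def R_def)
        qed
      qed
    qed (use w comp_D comp_refl in blast)
    moreover have "infinite (component B (mate w))" unfolding B_def
      using infinite_comp_block[OF u(1), of "mate w"] w mB by (auto simp: traps_def R_def B_def)
    ultimately show False using finD finite_subset by blast
  qed
  have finT: "finite T" using finD by (simp add: T_def)
  have R3: "card (exits S u) + card chords + card traps = 3"
  proof -
    have "R = (exits S u \<union> chords) \<union> traps" by (auto simp: exits chords_def traps_def)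
    hence "card R = card ((exits S u \<union> chords) \<union> traps)" by simp
    also have "\<dots> = card (exits S u) + card chords + card traps"
      using finR by (subst card_Un_disjoint, auto simp: exits chords_def traps_def)+
    finally show ?thesis using finR by simp
  qed
  have finE: "finite (exits S u)" using finR by (simp add: exits)
  have E1: "card (exits S u) \<ge> 1" using g finE by (metis One_nat_def Suc_leI card_gt_0_iff empty_iff)
  \<comment> \<open>The exit \<open>g\<close> leaves at most two traps. One trap is matched because
    \<open>T\<close> is nonempty; for two traps parity raises \<open>card T\<close> from at least 1
    to at least 2.\<close>
  have trapsT: "card traps \<le> card T"
  proof (cases "traps = {}")
    case False
    hence "card T \<ge> 1" using T_ne finT by (metis One_nat_def Suc_leI card_gt_0_iff)
    thus ?thesis using parity R3 E1 by presburger
  qed simp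
  have IV: "I \<subseteq> V" using I_bl by (simp add: blocky_def)
  have finX: "finite X" using finite_mate_in[OF u(5), of "I - {u}"] IV by (auto simp: X_def)
  have I'I: "I' \<subseteq> I" using mI gR by (simp add: I'_def)
  \<comment> \<open>An edge pending after leaving through \<open>g\<close> either comes from another
    usable exit of the current square or was pending before. A mate of a corner of the square that
    lies in \<open>I'\<close> sees an infinite component, so that corner counts as an exit.\<close>
  have sub': "{w \<in> I' - {mate g}. mate w \<in> S'} \<subseteq> mate ` (exits S u - {g}) \<union> (X \<inter> I')"
  proof
    fix z assume z: "z \<in> {w \<in> I' - {mate g}. mate w \<in> S'}"
    hence zV: "z \<in> V" and zS: "z \<notin> S'" using I'I IV I'S' by auto
    have zz: "mate (mate z) = z" using zV by simp
    show "z \<in> mate ` (exits S u - {g}) \<union> (X \<inter> I')"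
    proof (cases "mate z \<in> B")
      case True
      have "mate z \<noteq> u" using zz u(3) zS by (metis S'_def UnCI)
      moreover have "component S' z = I'" using comp_eq[of "mate g" S' z] z mI(2)[OF gR(1,2)] by (simp add: I'_def)
      ultimately have "mate z \<in> exits S u" using True zz zS gR by (auto simp: exits R_def S'_def)
      moreover have "mate z \<noteq> g" using z zz by auto
      ultimately show ?thesis using zz by (metis DiffI UnI1 imageI singletonD)
    next
      case False
      hence "mate z \<in> S" using z by (auto simp: S'_def)
      moreover have "z \<noteq> u" using zS B by (auto simp: S'_def)
      ultimately show ?thesis using z I'I by (auto simp: X_def)
    qed
  qed
  have "pending S' (mate g) \<le> card (mate ` (exits S u - {g}) \<union> (X \<inter> I'))"
    unfolding pending_def I'_def[symmetric] using sub' finE finX by (intro card_mono) auto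
  also have "\<dots> \<le> card (mate ` (exits S u - {g})) + card (X \<inter> I')" by (rule card_Un_le)
  also have "card (mate ` (exits S u - {g})) \<le> card (exits S u) - 1"
    using finE g card_image_le[of "exits S u - {g}" mate] by simp
  finally have p1: "pending S' (mate g) + 1 \<le> card (exits S u) + card (X \<inter> I')" using E1 by simp
  \<comment> \<open>Chords and pocket attachments were pending edges and are lost for the new
    component: the former end in the square just visited, the latter in finite components.\<close>
  have sub2: "chords \<union> T \<subseteq> X - I'"
  proof
    fix z assume "z \<in> chords \<union> T"
    thus "z \<in> X - I'"
    proof
      assume "z \<in> chords" thus ?thesis using BI I'S' by (auto simp: chords_def R_def X_def S'_def)
    next
      assume z: "z \<in> T"
      hence zD: "z \<in> D" "mate z \<in> S" by (auto simp: T_def)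
      have "D \<subseteq> I" using mI(1) by (auto simp: D_def traps_def)
      moreover have "z \<noteq> u" using zD DS' B by (auto simp: S'_def)
      moreover have "z \<notin> I'"
      proof
        assume "z \<in> I'"
        hence "component S' z = I'" using comp_eq[of "mate g" S' z] mI(2)[OF gR(1,2)] by (simp add: I'_def)
        thus False using D_fin[OF zD(1)] gR by simp
      qed
      ultimately show ?thesis using zD by (auto simp: X_def)
    qed
  qed
  have "card chords + card T = card (chords \<union> T)"
    using finR finT DS' by (subst card_Un_disjoint) (auto simp: chords_def T_def R_def S'_def)
  also have "\<dots> \<le> card (X - I')" using sub2 finX by (intro card_mono) auto
  also have "card (X - I') = card X - card (X \<inter> I')"
    using finX by (simp add: card_Diff_subset_Int)
  finally have p2: "card chords + card T + card (X \<inter> I') \<le> card X"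
    using finX card_mono[of X "X \<inter> I'"] by auto
  have "pending S u = card X" by (simp add: pending_def X_def I_def)
  thus ?thesis using p1 p2 trapsT R3 unfolding S'_def B_def by linarith
qed

end

section \<open>Lower bound from passages through squares\<close>

context cubic_graph
begin

text \<open>The six self-avoiding passages from \<open>u\<close> to another corner: each
  neighbouring corner is reached through 2 or 4 vertices, the opposite one in two ways through 3.
  The number of vertices equals the steps inside the square plus the leaving edge.\<close>

lemma gf_square:
  assumes x: "x \<ge> 0" and d: "distinct [u, a, c, b]" and S: "{u, a, c, b} \<inter> S = {}"
    and n: "a \<in> nbrs u" "c \<in> nbrs a" "b \<in> nbrs c" "b \<in> nbrs u"
    and n': "a' \<in> nbrs a" "b' \<in> nbrs b" "c' \<in> nbrs c"
  defines "S' \<equiv> S \<union> {u, a, c, b}"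
  shows "(x ^ 2 + x ^ 4) * (gf x S' a' N + gf x S' b' N) + 2 * x ^ 3 * gf x S' c' N \<le> gf x S u (Suc N)"
proof -
  define Q where "Q = {([u, a], a'), ([u, b, c, a], a'), ([u, b], b'), ([u, a, c, b], b'),
                       ([u, a, c], c'), ([u, b, c], c')}"
  have sym: "u \<in> nbrs a" "a \<in> nbrs c" "c \<in> nbrs b" "u \<in> nbrs b"
    using n nbrs_sym by auto
  have V: "u \<in> V" "a \<in> V" "b \<in> V" "c \<in> V" using n nbrsD by auto
  have "(\<Sum>(q, u')\<in>Q. x ^ length q * gf x (S \<union> {u, a, c, b}) u' N) \<le> gf x S u (Suc N)"
  proof (rule gf_Suc_ge[OF x])
    fix q u' assume "(q, u') \<in> Q"
    hence "(q, u') = ([u, a], a') \<or> (q, u') = ([u, b, c, a], a') \<or> (q, u') = ([u, b], b') \<or>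
           (q, u') = ([u, a, c, b], b') \<or> (q, u') = ([u, a, c], c') \<or> (q, u') = ([u, b, c], c')"
      unfolding Q_def by blast
    thus "walk V E q \<and> distinct q \<and> hd q = u \<and> set q \<subseteq> {u, a, c, b} \<and> length q \<le> 4 \<and> u' \<in> nbrs (last q)"
      using d n n' sym V by (elim disjE) (simp_all add: walk_Cons_iff eq_commute)
  qed (use S in \<open>simp_all add: Q_def\<close>)
  also have "(\<Sum>(q, u')\<in>Q. x ^ length q * gf x (S \<union> {u, a, c, b}) u' N) =
     x ^ 2 * gf x S' a' N + x ^ 4 * gf x S' a' N + x ^ 2 * gf x S' b' N + x ^ 4 * gf x S' b' N
     + x ^ 3 * gf x S' c' N + x ^ 3 * gf x S' c' N"
    using d unfolding Q_def S'_def[symmetric] by (simp add: eval_nat_numeral)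
  finally show ?thesis by (simp add: algebra_simps)
qed

end

text \<open>The values are 1, \<open>2 / sqrt 3\<close> and 1. Equality at 1 and 3 exits is what
  fixes both the rate \<open>sqrt 3\<close> and the exponent \<open>1/4\<close> per pending
  edge.\<close>

lemma three_powr_bound:
  assumes "r \<in> {1, 2, 3 :: nat}"
  shows "1 \<le> real r * 3 powr ((1 - real r) / 2)"
proof -
  have "3 powr (-1/2 :: real) = 1 / sqrt 3"
    by (simp add: powr_minus_divide powr_half_sqrt)
  moreover have "sqrt 3 \<le> 2" by (rule real_le_lsqrt) auto
  ultimately show ?thesis using assms by (auto simp: powr_minus_divide field_simps)
qed

context unique_square
begin

text \<open>Induction on the number of squares with the potential
  \<open>3 powr (- pending / 4)\<close>. With \<open>r\<close> exits, \<open>pending_exit\<close>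
  gives each successor at least \<open>3 powr (1 - r / 2)\<close> times the old potential;
  multiplied by \<open>r\<close> and by the exit weight \<open>2 * x ^ 3 = 3 powr (-1/2)\<close>,
  this is the quantity in \<open>three_powr_bound\<close>.\<close>

lemma gf_state_ge:
  assumes x: "x > 0" "12 * x ^ 6 = 1" and st: "state S u"
  shows "x * 3 powr (- real (pending S u) / 4) \<le> gf x S u N"
  using st
proof (induction N arbitrary: S u)
  case 0
  have "3 powr (- real (pending S u) / 4) \<le> 3 powr 0" by (rule powr_mono) auto
  hence "x * 3 powr (- real (pending S u) / 4) \<le> x" using x by simp
  thus ?case using 0 gf_0[of u S] by (simp add: state_def)
next
  case (Suc N)
  have u: "u \<in> V" "u \<notin> S" "blocky S" using Suc.prems by (auto simp: state_def)
  obtain a w b where sq: "square u a w b" and bl: "block u = {u, a, w, b}" and d: "distinct [u, a, w, b]"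
    by (rule block_cases[OF u(1)])
  define S' where "S' = S \<union> block u"
  define F where "F = (\<lambda>z. gf x S' (mate z) N)"
  define r where "r = card (exits S u)"
  define e where "e = real (pending S u)"
  have F0: "F z \<ge> 0" for z using gf_nonneg x by (simp add: F_def)
  have sub: "exits S u \<subseteq> {a, w, b}" using bl by (auto simp: exits_def)
  have fin: "finite (exits S u)" using sub finite_subset by blast
  have "r \<noteq> 0" using exits_nonempty[OF Suc.prems] fin by (simp add: r_def)
  moreover have "r \<le> 3" using card_mono[OF _ sub] d by (simp add: r_def)
  ultimately have r: "r \<in> {1, 2, 3}" by auto
  have V: "a \<in> V" "b \<in> V" "w \<in> V" using bl block_subset_V[OF u(1)] by auto
  have n: "a \<in> nbrs u" "w \<in> nbrs a" "b \<in> nbrs w" "b \<in> nbrs u"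
    using sq nbrs_sym[of b u] by (auto simp: square_def)
  have t3: "2 * x ^ 3 = 3 powr (-1/2)"
  proof -
    have "(2 * x ^ 3)\<^sup>2 = 4 * x ^ 6" by (simp add: power_mult_distrib flip: power_mult)
    also have "\<dots> = 1 / 3" using x by simp
    finally have "2 * x ^ 3 = sqrt (1 / 3)" using x by (intro real_sqrt_unique[symmetric]) auto
    thus ?thesis by (simp add: powr_minus_divide powr_half_sqrt real_sqrt_divide)
  qed
  have each: "x * 3 powr (1 - real r / 2 - e / 4) \<le> F z" if z: "z \<in> exits S u" for z
  proof -
    have "real (pending S' (mate z) + 4) \<le> real (pending S u + 2 * r)"
      using pending_exit[OF Suc.prems z] unfolding r_def S'_def of_nat_le_iff .
    hence "1 - real r / 2 - e / 4 \<le> - real (pending S' (mate z)) / 4" by (simp add: e_def)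
    hence "x * 3 powr (1 - real r / 2 - e / 4) \<le> x * 3 powr (- real (pending S' (mate z)) / 4)"
      using x by (intro mult_left_mono powr_mono) auto
    also have "\<dots> \<le> F z" unfolding F_def S'_def
      using Suc.IH[OF state_exit[OF Suc.prems z]] by simp
    finally show ?thesis .
  qed
  have "1 * (x * 3 powr (- e / 4)) \<le> (real r * 3 powr ((1 - real r) / 2)) * (x * 3 powr (- e / 4))"
    using three_powr_bound[OF r] x by (intro mult_right_mono) auto
  also have "\<dots> = real r * x * 3 powr ((1 - real r) / 2 + - e / 4)"
    by (simp only: powr_add mult_ac)
  also have "(1 - real r) / 2 + - e / 4 = (-1/2) + (1 - real r / 2 - e / 4)"
    by (simp add: field_simps)
  also have "real r * x * 3 powr ((-1/2) + (1 - real r / 2 - e / 4)) =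
             2 * x ^ 3 * (real r * (x * 3 powr (1 - real r / 2 - e / 4)))"
    unfolding powr_add t3 by (simp only: mult_ac)
  also have "\<dots> \<le> 2 * x ^ 3 * (\<Sum>z\<in>exits S u. F z)"
    using x sum_bounded_below[of "exits S u" _ F, OF each] by (intro mult_left_mono) (auto simp: r_def)
  \<comment> \<open>Blocked corners contribute nonnegative terms, so the sum may run over all three
    corners, as the square recursion requires.\<close>
  also have "\<dots> \<le> 2 * x ^ 3 * (\<Sum>z\<in>{a, w, b}. F z)"
    using x sub F0 by (intro mult_left_mono sum_mono2) auto
  also have "\<dots> = 2 * x ^ 3 * (F a + F b) + 2 * x ^ 3 * F w" using d by (simp add: algebra_simps)
  also have "\<dots> \<le> (x ^ 2 + x ^ 4) * (F a + F b) + 2 * x ^ 3 * F w"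
  proof -
    have "0 \<le> (x * (x - 1))\<^sup>2" by simp
    also have "\<dots> = x ^ 2 + x ^ 4 - 2 * x ^ 3" by (simp add: eval_nat_numeral algebra_simps)
    finally show ?thesis using F0[of a] F0[of b] by (intro add_right_mono mult_right_mono) auto
  qed
  also have "\<dots> \<le> gf x S u (Suc N)"
    unfolding F_def S'_def bl
    using gf_square[of x u a w b S "mate a" "mate b" "mate w" N]
      x d n V mate_nbrs blocky_disjoint[OF u(3,1,2)] bl by auto
  finally show ?case by (simp add: e_def)
qed

text \<open>A state needs a visited square behind the entrance. Declaring the square of
  \<open>mate v\<close> visited only restricts the walks from \<open>v\<close>, and what remains is
  infinite by \<open>infinite_comp_block\<close>.\<close>

lemma connective_constant_ge:
  assumes x: "x > 0" "12 * x ^ 6 = 1"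
  shows "1 / x \<le> connective_constant V E"
proof -
  obtain v where v: "v \<in> V" using infinite_V by fastforce
  define S where "S = block (mate v)"
  have mv: "mate v \<in> V" using v mate_V by simp
  have "v \<notin> S" using mate_notin_block[OF mv] v by (simp add: S_def)
  hence "state S v"
    using v mv infinite_comp_block[OF mv v] finite_block[OF mv] blocky_block[OF mv]
    by (simp add: state_def S_def)
  hence "x * 3 powr (- real (pending S v) / 4) \<le> gf x S v N" for N
    by (rule gf_state_ge[OF x])
  from root_limit_ge[OF x(1) _ this connective_constant_limit[OF v]] show ?thesis
    using x by simp
qed

section \<open>Upper bound from weights on partial passages\<close>

definition trail :: "'a list \<Rightarrow> nat" where
  "trail q = length (takeWhile (\<lambda>t. t \<in> block (hd q)) q)"

text \<open>For \<open>j\<close> corners already visited, the generating function in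
  \<open>z\<close> of the ways to finish the passage, leaving edge included: from the fourth corner
  only leaving (\<open>z\<close>), from the third leaving or going on (\<open>z * (1 + z)\<close>),
  and so on. For a fresh entrance it is \<open>2 * z * (z * (1 + z + z ^ 2))\<close>, and the
  equation defining \<open>zeta\<close> says that this is 1.\<close>

definition weight :: "real \<Rightarrow> nat \<Rightarrow> real" where
  "weight z j = (if j \<le> 1 then 1 else if j = 2 then z * (1 + z + z ^ 2)
                 else if j = 3 then z * (1 + z) else z)"

lemma weight_ge: "0 < z \<Longrightarrow> z < 1 \<Longrightarrow> z \<le> weight z j"
  by (auto simp: weight_def)

lemma trail_Cons:
  assumes "s \<in> V" "t \<in> block s"
  shows "trail (t # s # r) = Suc (trail (s # r))"
  using block_eq[OF assms] assms by (simp add: trail_def)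

lemma trail_mate:
  assumes "s \<in> V"
  shows "trail (mate s # s # r) = 1"
proof -
  have "s \<notin> block (mate s)" using mate_notin_block[OF mate_V[OF assms]] assms by simp
  thus ?thesis by (simp add: trail_def)
qed

text \<open>Self-avoidance is enforced only against the predecessor and within the current passage;
  earlier visits can only remove extensions. The predecessor \<open>y\<close> tells whether the
  square has just been entered.\<close>

lemma weight_extensions:
  assumes z: "0 < z" "z < 1" "2 * z\<^sup>2 * (1 + z + z\<^sup>2) = 1"
    and q: "distinct (s # y # r)" "s \<in> V" "y \<in> nbrs s"
  shows "(\<Sum>t\<in>nbrs s - set (s # y # r). weight z (trail (t # s # y # r)))
           \<le> 1 / z * weight z (trail (s # y # r))"
proof -
  obtain a w b where bl: "block s = {s, a, w, b}" and d: "distinct [s, a, w, b]"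
    and nb: "nbrs s = {a, b, mate s}" and mt: "mate s \<notin> {s, a, w, b}"
    by (rule block_cases[OF q(2)])
  define T where "T = trail (s # y # r)"
  define W where "W = (\<lambda>t. weight z (trail (t # s # y # r)))"
  have W0: "W t \<ge> 0" for t using weight_ge[OF z(1,2)] z(1) unfolding W_def by (meson less_le_trans less_imp_le)
  have Wm: "W (mate s) = 1" using trail_mate[OF q(2)] by (simp add: W_def weight_def)
  have Wb: "W t = weight z (Suc T)" if "t \<in> block s" for t
    using trail_Cons[OF q(2) that] by (simp add: W_def T_def)
  have sumle: "(\<Sum>t\<in>nbrs s - set (s # y # r). W t) \<le> (\<Sum>t\<in>Y. W t)"
    if "nbrs s - set (s # y # r) \<subseteq> Y" "finite Y" for Y
    using that W0 by (intro sum_mono2) auto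
  have "(\<Sum>t\<in>nbrs s - set (s # y # r). W t) \<le> 1 / z * weight z T"
  proof (cases "y = mate s")
    case True
    hence T: "T = 1" using mt bl by (simp add: T_def trail_def)
    have "(\<Sum>t\<in>nbrs s - set (s # y # r). W t) \<le> (\<Sum>t\<in>{a, b}. W t)"
      using nb True by (intro sumle) auto
    also have "\<dots> = 2 * (z * (1 + z + z ^ 2))"
      using d bl Wb[of a] Wb[of b] T by (simp add: weight_def)
    also have "\<dots> = 1 / z" using z by (simp add: field_simps power2_eq_square)
    finally show ?thesis using T by (simp add: weight_def)
  next
    case False
    then obtain b' where b': "b' \<in> {a, b}" "b' \<noteq> y" "y \<in> {a, b}" "nbrs s = {y, b', mate s}"
      using q(3) nb d by auto
    have yb: "y \<in> block s" "b' \<in> block s" "b' \<noteq> s" "b' \<noteq> mate s" using b' bl d mt by auto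
    have T2: "T \<ge> 2" using yb by (simp add: T_def trail_def)
    show ?thesis
    proof (cases "b' \<in> set r")
      case True
      \<comment> \<open>Only the leaving edge remains, with weight 1, and every weight is at least
        \<open>z\<close>.\<close>
      have "(\<Sum>t\<in>nbrs s - set (s # y # r). W t) \<le> (\<Sum>t\<in>{mate s}. W t)"
        using b' True by (intro sumle) auto
      also have "\<dots> \<le> 1 / z * weight z T"
        using Wm weight_ge[OF z(1,2), of T] z by (simp add: field_simps)
      finally show ?thesis .
    next
      case False
      \<comment> \<open>The trail consists of distinct corners and misses \<open>b'\<close>, so at
        most three corners are used and the recursion for \<open>weight\<close> holds with
        equality.\<close>
      have "T = card (set (takeWhile (\<lambda>t. t \<in> block s) (s # y # r)))"
        using distinct_takeWhile[OF q(1), of "\<lambda>t. t \<in> block s"]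
        by (simp only: T_def trail_def list.sel distinct_card)
      also have "\<dots> \<le> card (block s - {b'})"
      proof (rule card_mono)
        show "finite (block s - {b'})" using bl by simp
        show "set (takeWhile (\<lambda>t. t \<in> block s) (s # y # r)) \<subseteq> block s - {b'}"
        proof
          fix t assume "t \<in> set (takeWhile (\<lambda>t. t \<in> block s) (s # y # r))"
          hence "t \<in> block s" "t \<in> set (s # y # r)" using set_takeWhileD by fastforce+
          thus "t \<in> block s - {b'}" using False b'(2) yb(3) by auto
        qed
      qed
      also have "\<dots> = 3" using card_block[OF q(2)] yb bl by simp
      finally have T: "T = 2 \<or> T = 3" using T2 by auto
      have "(\<Sum>t\<in>nbrs s - set (s # y # r). W t) \<le> (\<Sum>t\<in>{mate s, b'}. W t)"
        using b' by (intro sumle) auto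
      also have "\<dots> = 1 + weight z (Suc T)" using Wm Wb[OF yb(2)] yb(4) by simp
      also have "\<dots> = 1 / z * weight z T"
        using T z by (auto simp: weight_def field_simps power2_eq_square)
      finally show ?thesis .
    qed
  qed
  thus ?thesis by (simp add: W_def T_def)
qed

lemma connective_constant_le:
  assumes z: "0 < z" "z < 1" "2 * z\<^sup>2 * (1 + z + z\<^sup>2) = 1"
  shows "connective_constant V E \<le> 1 / z"
proof -
  obtain v where v: "v \<in> V" using infinite_V by fastforce
  define f where "f = (\<lambda>q. weight z (trail q))"
  have f_ge: "z \<le> f q" for q using weight_ge z by (simp add: f_def)
  have step: "(\<Sum>w\<in>nbrs (last p) - set p. f (w # rev p)) \<le> 1 / z * f (rev p)"
    if n: "n \<ge> 1" and p: "p \<in> saws V E n v" for n p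
  proof -
    have w: "walk V E p" "distinct p" "length p \<ge> 2" using n p by (auto simp: saws_def)
    have "\<exists>s y r. q = s # y # r" if "length q \<ge> 2" for q :: "'a list"
      using that by (auto simp: numeral_2_eq_2 Suc_le_length_iff)
    from this[of "rev p"] obtain s y r where rp: "rev p = s # y # r" using w(3) by auto
    have pe: "p = rev r @ [y, s]" using arg_cong[OF rp, of rev] by simp
    have ys: "y \<in> nbrs s" "s \<in> V"
      using w(1) pe by (auto simp: walk_def successively_append_iff nbrs_def insert_commute)
    have "distinct (s # y # r)" using w(2) rp distinct_rev by metis
    moreover have "set p = set (s # y # r)" using rp set_rev by metis
    moreover have "last p = s" using pe by simp
    ultimately show ?thesis using weight_extensions[OF z _ ys(2,1)] rp by (simp only: f_def)
  qed
  define C where "C = (1 + (\<Sum>p\<in>saws V E 1 v. f (rev p))) / z / (1 / z) ^ 1"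
  have "(\<Sum>p\<in>saws V E 1 v. f (rev p)) \<ge> 0"
    using f_ge z by (intro sum_nonneg) (meson less_le_trans less_imp_le)
  hence "C > 0" using z by (simp add: C_def)
  moreover have "real (num_saws V E n v) \<le> C * (1 / z) ^ n" if "n \<ge> 1" for n
    unfolding C_def using num_saws_le_weight[of 1 n "1 / z" z f v] that z f_ge step by simp
  ultimately show ?thesis
    using root_limit_le[OF connective_constant_limit[OF v], of 1 C "1 / z"] z by simp
qed

end

section \<open>Ladders\<close>

context cubic_girth4
begin

text \<open>By transitivity every vertex would have a twin. A twin of a neighbour of
  \<open>u\<close> is again a neighbour of \<open>u\<close>, and three vertices without a twinless
  one among them all share their neighbours. This closes up to the finite graph
  \<open>K_{3,3}\<close>.\<close>

lemma no_twins:
  assumes "u \<in> V" "v \<in> V" "u \<noteq> v"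
  shows "nbrs u \<noteq> nbrs v"
proof
  assume eq: "nbrs u = nbrs v"
  have twin: "\<exists>y. y \<noteq> x \<and> nbrs y = nbrs x" if x: "x \<in> V" for x
  proof -
    obtain f where f: "automorphism V E f" "f u = x" "inj_on f V"
      using automorphism_obtain[OF assms(1) x] by metis
    have "nbrs (f v) = nbrs (f u)" using automorphism_nbrs[OF f(1)] assms eq by simp
    moreover have "f v \<noteq> f u" using f(3) assms by (auto dest: inj_onD)
    ultimately show ?thesis using f(2) by auto
  qed
  obtain a b c where abc: "nbrs u = {a, b, c}" "a \<noteq> b" "a \<noteq> c" "b \<noteq> c"
    using card_nbrs[OF assms(1)] by (auto simp: card_3_iff)
  have V: "a \<in> V" "b \<in> V" "c \<in> V" using abc nbrsD[of _ u] by auto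
  have tw: "\<exists>y\<in>{a, b, c}. y \<noteq> x \<and> nbrs y = nbrs x" if x: "x \<in> {a, b, c}" for x
  proof -
    obtain y where y: "y \<noteq> x" "nbrs y = nbrs x" using twin[of x] x V by auto
    have "u \<in> nbrs x" using x abc nbrs_sym by auto
    hence "y \<in> nbrs u" using y nbrs_sym by auto
    thus ?thesis using y abc by auto
  qed
  have same: "nbrs a = nbrs b \<and> nbrs b = nbrs c"
    using tw[of a] tw[of b] tw[of c] by auto
  have "infinite (nbrs u \<union> nbrs a)"
  proof (rule closed_infinite)
    fix w z assume w: "w \<in> nbrs u \<union> nbrs a" and z: "z \<in> nbrs w"
    show "z \<in> nbrs u \<union> nbrs a"
    proof (cases "w \<in> nbrs u")
      case True
      hence "nbrs w = nbrs a" using same abc by auto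
      thus ?thesis using z by simp
    next
      case False
      hence "w \<in> nbrs a" "w \<in> nbrs b" "w \<in> nbrs c" using w same by auto
      hence "nbrs w = {a, b, c}" using abc nbrs_sym[of _ w] by (intro nbrs_eqI) auto
      thus ?thesis using z abc by blast
    qed
  next
    show "nbrs u \<union> nbrs a \<subseteq> V" using nbrsD(2) by blast
    show "nbrs u \<union> nbrs a \<noteq> {}" using abc by simp
  qed
  thus False by simp
qed

lemma no_three_common:
  assumes "{a, b, c} \<subseteq> nbrs u" "{a, b, c} \<subseteq> nbrs v" "a \<noteq> b" "a \<noteq> c" "b \<noteq> c"
  shows "u = v"
proof (rule ccontr)
  assume "u \<noteq> v"
  moreover have "nbrs u = {a, b, c}" using assms by (intro nbrs_eqI) auto
  moreover have "nbrs v = {a, b, c}" using assms by (intro nbrs_eqI) auto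
  moreover have "u \<in> V" "v \<in> V" using assms nbrsD[of a] by auto
  ultimately show False using no_twins by metis
qed

text \<open>The edges from \<open>v\<close> to \<open>a\<close> and to \<open>b\<close> are
  consecutive edges of a common square.\<close>

definition paired :: "'a \<Rightarrow> 'a \<Rightarrow> 'a \<Rightarrow> bool" where
  "paired v a b \<longleftrightarrow> a \<noteq> b \<and> a \<in> nbrs v \<and> b \<in> nbrs v \<and> (\<exists>w. w \<noteq> v \<and> a \<in> nbrs w \<and> b \<in> nbrs w)"

lemma paired_sym: "paired v a b \<longleftrightarrow> paired v b a"
  by (auto simp: paired_def)

lemma square_paired:
  assumes "square v a w b"
  shows "paired v a b"
proof -
  have "a \<noteq> b" "a \<in> nbrs v" "b \<in> nbrs v" "w \<noteq> v" "a \<in> nbrs w" "b \<in> nbrs w"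
    using assms nbrs_sym[of b v] nbrs_sym[of a w] by (auto simp: square_def)
  thus ?thesis unfolding paired_def by blast
qed

lemma paired_automorphism:
  assumes f: "automorphism V E f" and p: "paired v a b"
  shows "paired (f v) (f a) (f b)"
proof -
  obtain w where w: "w \<noteq> v" "a \<in> nbrs w" "b \<in> nbrs w" using p by (auto simp: paired_def)
  have n: "a \<noteq> b" "a \<in> nbrs v" "b \<in> nbrs v" using p by (auto simp: paired_def)
  have V: "v \<in> V" "w \<in> V" "a \<in> V" "b \<in> V" using w n nbrsD by blast+
  have inj: "inj_on f V" using f by (auto simp: automorphism_def bij_betw_def)
  have "f w \<noteq> f v" "f a \<noteq> f b" using inj_onD[OF inj] V w(1) n(1) by blast+
  moreover have "f a \<in> nbrs (f v)" "f b \<in> nbrs (f v)" "f a \<in> nbrs (f w)" "f b \<in> nbrs (f w)"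
    using automorphism_nbrs[OF f] V w n by auto
  ultimately show ?thesis unfolding paired_def by blast
qed

text \<open>If every two edges at a vertex lay on a common square, the squares around
  \<open>v\<close> would close up to the eight vertices of a cube: \<open>v\<close>, its neighbours,
  the opposite corners \<open>w1\<close>, \<open>w2\<close>, \<open>w3\<close>, and one antipode
  \<open>z\<close>.\<close>

lemma not_all_paired:
  assumes "v \<in> V"
  shows "\<exists>a b. a \<noteq> b \<and> a \<in> nbrs v \<and> b \<in> nbrs v \<and> \<not> paired v a b"
proof (rule ccontr)
  assume no: "\<not> ?thesis"
  have all: "paired u a b" if u: "a \<noteq> b" "a \<in> nbrs u" "b \<in> nbrs u" for u a b
  proof -
    have uV: "u \<in> V" using u nbrsD by blast
    obtain f where f: "automorphism V E f" "f v = u"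
      using automorphism_obtain[OF assms uV] by metis
    then obtain a' b' where ab': "a = f a'" "b = f b'" "a' \<in> nbrs v" "b' \<in> nbrs v"
      using u automorphism_nbrs[OF f(1) assms] by auto
    moreover have "a' \<noteq> b'" using ab' u(1) by auto
    hence "paired v a' b'" using no ab'(3,4) by metis
    ultimately show ?thesis using paired_automorphism[OF f(1)] f(2) by metis
  qed
  obtain a b c where abc: "nbrs v = {a, b, c}" and d: "a \<noteq> b" "a \<noteq> c" "b \<noteq> c"
    using card_nbrs[OF assms] by (auto simp: card_3_iff)
  have na: "v \<in> nbrs a" "v \<in> nbrs b" "v \<in> nbrs c" using abc nbrs_sym[of v] by auto
  obtain w1 where w1: "w1 \<noteq> v" "a \<in> nbrs w1" "b \<in> nbrs w1"
    using all[of a b v] abc d by (auto simp: paired_def)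
  obtain w2 where w2: "w2 \<noteq> v" "a \<in> nbrs w2" "c \<in> nbrs w2"
    using all[of a c v] abc d by (auto simp: paired_def)
  obtain w3 where w3: "w3 \<noteq> v" "b \<in> nbrs w3" "c \<in> nbrs w3"
    using all[of b c v] abc d by (auto simp: paired_def)
  have w: "w1 \<noteq> w2" "w1 \<noteq> w3" "w2 \<noteq> w3"
    using no_three_common[of a b c v] w1 w2 w3 abc d by auto
  have nw: "w1 \<in> nbrs a" "w2 \<in> nbrs a" "w1 \<in> nbrs b" "w3 \<in> nbrs b" "w2 \<in> nbrs c" "w3 \<in> nbrs c"
    using w1 w2 w3 nbrs_sym by blast+
  have Na: "nbrs a = {v, w1, w2}" using na nw w w1 w2 by (intro nbrs_eqI) auto
  have Nb: "nbrs b = {v, w1, w3}" using na nw w w1 w3 by (intro nbrs_eqI) auto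
  have Nc: "nbrs c = {v, w2, w3}" using na nw w w2 w3 by (intro nbrs_eqI) auto
  obtain z where z: "nbrs w1 = {a, b, z}" "z \<noteq> a" "z \<noteq> b"
    using nbrs_third[OF w1(2,3) d(1)] by blast
  have "paired a w1 w2" "paired b w1 w3" using all Na Nb w by auto
  then obtain t s where t: "t \<noteq> a" "w1 \<in> nbrs t" "w2 \<in> nbrs t" and s: "s \<noteq> b" "w1 \<in> nbrs s" "w3 \<in> nbrs s"
    by (auto simp: paired_def)
  have "t \<in> nbrs w1" "s \<in> nbrs w1" using t s nbrs_sym by auto
  moreover have "t \<noteq> b" using t Nb w w2 by auto
  moreover have "s \<noteq> a" using s Na w w3 by auto
  ultimately have ts: "t = z" "s = z" using z t s by auto
  have zc: "z \<noteq> c" using t ts Nc w w1 by auto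
  have Nz: "nbrs z = {w1, w2, w3}" using t(2,3) s(2,3) w unfolding ts by (intro nbrs_eqI) auto
  have zn: "z \<in> nbrs w2" "z \<in> nbrs w3" using Nz nbrs_sym by auto
  have N2: "nbrs w2 = {a, c, z}" using w2 zn d z zc by (intro nbrs_eqI) auto
  have N3: "nbrs w3 = {b, c, z}" using w3 zn d z zc by (intro nbrs_eqI) auto
  have "infinite {v, a, b, c, w1, w2, w3, z}"
  proof (rule closed_infinite)
    show "{v, a, b, c, w1, w2, w3, z} \<subseteq> V"
      using assms nbrsD(2)[of _ v] nbrsD(1)[of w1 z] nbrsD(2)[of _ z] unfolding abc Nz by blast
    fix x y assume "x \<in> {v, a, b, c, w1, w2, w3, z}" "y \<in> nbrs x"
    thus "y \<in> {v, a, b, c, w1, w2, w3, z}" using abc Na Nb Nc z N2 N3 Nz by auto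
  qed auto
  thus False by simp
qed

end

text \<open>The rungs form a perfect matching, and \<open>rung_step\<close> says that every other
  edge spans a square with the rungs at its two ends. This local structure stands in for an
  identification with the two-way infinite ladder.\<close>

locale ladder = cubic_girth4 +
  fixes rung :: "'a \<Rightarrow> 'a"
  assumes rung_nbrs: "v \<in> V \<Longrightarrow> rung v \<in> nbrs v"
    and rung_rung: "v \<in> V \<Longrightarrow> rung (rung v) = v"
    and rung_step: "b \<in> nbrs v \<Longrightarrow> b \<noteq> rung v \<Longrightarrow> rung b \<in> nbrs (rung v)"

context cubic_girth4
begin

text \<open>At each vertex exactly two of the three pairs of neighbours are \<open>paired\<close>:
  at least two by transitivity, not three by \<open>not_all_paired\<close>. The neighbour common to
  both pairs is the rung.\<close>

lemma ladder_if_two_squares: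
  assumes sq: "square v0 a w b" "square v0 a' w' b'" "{v0, a, w, b} \<noteq> {v0, a', w', b'}"
  shows "\<exists>rung. ladder V E rung"
proof -
  have v0: "v0 \<in> V" using sq nbrsD by (auto simp: square_def)
  have pairs: "paired v0 a b" "paired v0 a' b'"
    using sq square_paired by blast+
  \<comment> \<open>Two squares with the same sides \<open>a\<close>, \<open>b\<close> but different
    far corners would give \<open>a\<close> and \<open>b\<close> three common neighbours.\<close>
  have diff: "{a, b} \<noteq> {a', b'}"
  proof
    assume eq: "{a, b} = {a', b'}"
    have "w = w'"
    proof (rule ccontr)
      assume "w \<noteq> w'"
      have "{v0, w, w'} \<subseteq> nbrs a" "{v0, w, w'} \<subseteq> nbrs b" "v0 \<noteq> w" "v0 \<noteq> w'" "a \<noteq> b"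
        using sq eq nbrs_sym unfolding square_def doubleton_eq_iff by blast+
      thus False using no_three_common[of v0 w w' a b] \<open>w \<noteq> w'\<close> by blast
    qed
    thus False using eq sq(3) by blast
  qed
  have ex0: "\<exists>x y z. nbrs v0 = {x, y, z} \<and> x \<noteq> y \<and> x \<noteq> z \<and> y \<noteq> z \<and> paired v0 x y \<and> paired v0 x z"
  proof -
    have ab: "a \<in> nbrs v0" "b \<in> nbrs v0" "a \<noteq> b" and ab': "a' \<in> nbrs v0" "b' \<in> nbrs v0" "a' \<noteq> b'"
      using pairs by (auto simp: paired_def)
    obtain c where c: "nbrs v0 = {a, b, c}" "c \<noteq> a" "c \<noteq> b" using nbrs_third[OF ab] by blast
    have "paired v0 a c \<or> paired v0 b c"
      using ab' c(1) diff pairs(2) paired_sym by (auto simp: doubleton_eq_iff)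
    thus ?thesis
    proof
      assume "paired v0 a c" thus ?thesis using c ab pairs by blast
    next
      assume "paired v0 b c"
      moreover have "nbrs v0 = {b, a, c}" using c(1) by auto
      ultimately show ?thesis using c ab pairs paired_sym by blast
    qed
  qed
  have ex: "\<exists>x y z. nbrs v = {x, y, z} \<and> x \<noteq> y \<and> x \<noteq> z \<and> y \<noteq> z \<and>
              paired v x y \<and> paired v x z \<and> \<not> paired v y z" if v: "v \<in> V" for v
  proof -
    obtain f where f: "automorphism V E f" "f v0 = v" "inj_on f V"
      using automorphism_obtain[OF v0 v] by metis
    obtain x y z where xyz: "nbrs v0 = {x, y, z}" "x \<noteq> y" "x \<noteq> z" "y \<noteq> z" "paired v0 x y" "paired v0 x z"
      using ex0 by blast
    have "x \<in> V" "y \<in> V" "z \<in> V" using xyz(1) nbrsD[of _ v0] by auto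
    hence "f x \<noteq> f y" "f x \<noteq> f z" "f y \<noteq> f z" using inj_onD[OF f(3)] xyz by blast+
    moreover have "nbrs v = {f x, f y, f z}" using automorphism_nbrs[OF f(1) v0] f(2) xyz(1) by simp
    moreover have "paired v (f x) (f y)" "paired v (f x) (f z)"
      using paired_automorphism[OF f(1)] xyz(5,6) f(2) by metis+
    moreover have "\<not> paired v (f y) (f z)"
    proof
      assume "paired v (f y) (f z)"
      moreover obtain p q where pq: "p \<noteq> q" "p \<in> nbrs v" "q \<in> nbrs v" "\<not> paired v p q"
        using not_all_paired[OF v] by blast
      moreover have "p \<in> {f x, f y, f z}" "q \<in> {f x, f y, f z}"
        using pq \<open>nbrs v = {f x, f y, f z}\<close> by auto
      ultimately show False
        using \<open>paired v (f x) (f y)\<close> \<open>paired v (f x) (f z)\<close> paired_sym by (metis insertE singletonD)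
    qed
    ultimately show ?thesis by blast
  qed
  define rung where "rung = (\<lambda>v. THE x. x \<in> nbrs v \<and> (\<forall>y\<in>nbrs v. y \<noteq> x \<longrightarrow> paired v x y))"
  have rung: "\<exists>y z. nbrs v = {rung v, y, z} \<and> rung v \<noteq> y \<and> rung v \<noteq> z \<and> y \<noteq> z \<and>
              paired v (rung v) y \<and> paired v (rung v) z \<and> \<not> paired v y z" if v: "v \<in> V" for v
  proof -
    obtain x y z where xyz: "nbrs v = {x, y, z}" "x \<noteq> y" "x \<noteq> z" "y \<noteq> z"
      "paired v x y" "paired v x z" "\<not> paired v y z" using ex[OF v] by blast
    have "\<not> paired v z y" using xyz(7) paired_sym by blast
    have "rung v = x" unfolding rung_def
    proof (rule the_equality)
      show "x \<in> nbrs v \<and> (\<forall>y\<in>nbrs v. y \<noteq> x \<longrightarrow> paired v x y)" using xyz by auto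
      fix t assume "t \<in> nbrs v \<and> (\<forall>y\<in>nbrs v. y \<noteq> t \<longrightarrow> paired v t y)"
      thus "t = x" using xyz \<open>\<not> paired v z y\<close> by auto
    qed
    thus ?thesis using xyz by blast
  qed
  have cases: "rung v = p \<or> rung v = q" if p: "paired v p q" for v p q
  proof -
    have "v \<in> V" "p \<in> nbrs v" "q \<in> nbrs v" "p \<noteq> q" using p nbrsD by (auto simp: paired_def)
    moreover obtain y z where yz: "nbrs v = {rung v, y, z}" "\<not> paired v y z"
      using rung[OF calculation(1)] by blast
    moreover have "\<not> paired v z y" using yz(2) paired_sym[of v y z] by simp
    ultimately show ?thesis using p by auto
  qed
  \<comment> \<open>The two squares on the rung at \<open>v\<close> have distinct far corners
    \<open>w\<close>, \<open>w'\<close>, both adjacent to \<open>rung v\<close>. So at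
    \<open>rung v\<close> the vertex \<open>v\<close> is paired with both, which singles it out as
    the rung there.\<close>
  have rr: "rung (rung v) = v" if v: "v \<in> V" for v
  proof -
    obtain b c where bc: "nbrs v = {rung v, b, c}" "rung v \<noteq> b" "rung v \<noteq> c" "b \<noteq> c"
      "paired v (rung v) b" "paired v (rung v) c" using rung[OF v] by blast
    obtain w where w: "w \<noteq> v" "rung v \<in> nbrs w" "b \<in> nbrs w" using bc(5) by (auto simp: paired_def)
    obtain w' where w': "w' \<noteq> v" "rung v \<in> nbrs w'" "c \<in> nbrs w'" using bc(6) by (auto simp: paired_def)
    have ww: "w \<noteq> w'" using no_three_common[of "rung v" b c v w] w w' bc by auto
    have "v \<in> nbrs (rung v)" "v \<in> nbrs b" "v \<in> nbrs c" "w \<in> nbrs (rung v)" "w' \<in> nbrs (rung v)"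
      "w \<in> nbrs b" "w' \<in> nbrs c"
      using bc(1) w w' nbrs_sym by auto
    hence "paired (rung v) v w" "paired (rung v) v w'"
      using w(1) w'(1) bc(2,3) unfolding paired_def by metis+
    thus ?thesis using cases ww by metis
  qed
  have "ladder V E rung"
  proof (unfold_locales)
    fix v assume v: "v \<in> V"
    show "rung v \<in> nbrs v" using rung[OF v] by auto
    show "rung (rung v) = v" by (rule rr[OF v])
  next
    fix b v assume b: "b \<in> nbrs v" "b \<noteq> rung v"
    have V: "v \<in> V" "b \<in> V" using b nbrsD by auto
    have "paired v (rung v) b" using rung[OF V(1)] b by auto
    then obtain w where w: "w \<noteq> v" "rung v \<in> nbrs w" "b \<in> nbrs w" by (auto simp: paired_def)
    have "v \<in> nbrs b" "w \<in> nbrs b" "v \<in> nbrs (rung v)" "w \<in> nbrs (rung v)"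
      using rung[OF V(1)] b w nbrs_sym by auto
    hence "paired b v w" using w(1) b(2) unfolding paired_def by metis
    moreover have "rung b \<noteq> v" using rr[OF V(2)] b(2) by auto
    ultimately have "rung b = w" using cases by metis
    thus "rung b \<in> nbrs (rung v)" using \<open>w \<in> nbrs (rung v)\<close> by simp
  qed
  thus ?thesis by blast
qed

end

section \<open>Bounds for ladders\<close>

context ladder
begin

text \<open>The blocks are now rungs: a walk entering at \<open>u\<close> either goes straight on,
  with one vertex, or crosses the rung first, with two. The recursion factor
  \<open>x + x\<^sup>2\<close> is at least 1 exactly when \<open>1 / x\<close> is at most the golden
  ratio.\<close>

lemma gf_ladder_ge:
  assumes x: "x > 0" "x + x\<^sup>2 \<ge> 1"
    and S: "finite S" "\<And>z. z \<in> S \<Longrightarrow> rung z \<in> S" "u \<in> V" "u \<notin> S" "infinite (component S u)"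
  shows "x \<le> gf x S u N"
  using S
proof (induction N arbitrary: S u)
  case 0 thus ?case using gf_0[of u S x] by simp
next
  case (Suc N)
  define B where "B = {u, rung u}"
  define S' where "S' = S \<union> B"
  have rr: "rung (rung z) = z" if "z \<in> V" for z using rung_rung that .
  have ru: "rung u \<in> nbrs u" "u \<in> nbrs (rung u)" "rung u \<in> V" "rung u \<noteq> u"
    using rung_nbrs[OF Suc.prems(3)] nbrs_sym nbrsD by blast+
  have "rung u \<notin> S" using Suc.prems(2)[of "rung u"] rr[OF Suc.prems(3)] Suc.prems(4) by auto
  obtain w z where wz: "w \<in> B" "z \<in> nbrs w" "z \<notin> S'" "infinite (component S' z)"
    using infinite_comp_exit[OF Suc.prems(4,5), of B] unfolding S'_def B_def by blast
  have zV: "z \<in> V" using wz nbrsD by blast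
  have S'_closed: "rung y \<in> S'" if "y \<in> S'" for y
    using that Suc.prems(2) rr[OF Suc.prems(3)] by (auto simp: S'_def B_def)
  have rz: "rung z \<notin> S'" using S'_closed[of "rung z"] rr[OF zV] wz by auto
  hence m: "rung z \<in> component S' z" using comp_step[of z S' z "rung z"] rung_nbrs[OF zV] by simp
  have inf: "infinite (component S' (rung z))" using comp_eq[OF wz(3) m] wz(4) by simp
  have zn: "z \<noteq> rung w"
  proof
    assume "z = rung w"
    hence "z \<in> B" using wz(1) rr[OF Suc.prems(3)] by (auto simp: B_def)
    thus False using wz(3) by (simp add: S'_def)
  qed
  have rzn: "rung z \<in> nbrs (rung w)" using rung_step wz zn by simp
  \<comment> \<open>The infinite side may be found from either end of the rung;
    \<open>rung_step\<close> gives the parallel edge at the other end.\<close>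
  obtain b where b: "b \<in> nbrs u" "rung b \<in> nbrs (rung u)" "b \<in> V" "rung b \<in> V" "b \<notin> S'" "rung b \<notin> S'"
    "infinite (component S' b)" "infinite (component S' (rung b))"
  proof (cases "w = u")
    case True
    show ?thesis using that[of z] True wz rz rzn inf zV rung_nbrs[OF zV] nbrsD by blast
  next
    case False
    hence w: "w = rung u" using wz by (simp add: B_def)
    hence "rung z \<in> nbrs u" using rzn rr[OF Suc.prems(3)] by simp
    thus ?thesis using that[of "rung z"] w wz rz inf zV rr[OF zV] rung_nbrs[OF zV] nbrsD by metis
  qed
  have IH: "x \<le> gf x S' b N" "x \<le> gf x S' (rung b) N"
    using b Suc.prems(1) S'_closed by (auto intro!: Suc.IH simp: S'_def B_def)
  have "(\<Sum>(q, u')\<in>{([u], b), ([u, rung u], rung b)}. x ^ length q * gf x (S \<union> B) u' N) \<le> gf x S u (Suc N)"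
    using x ru b Suc.prems(3,4) \<open>rung u \<notin> S\<close>
    by (intro gf_Suc_ge) (auto simp: walk_Cons_iff B_def)
  hence "x * gf x S' b N + x\<^sup>2 * gf x S' (rung b) N \<le> gf x S u (Suc N)"
    by (simp add: S'_def power2_eq_square)
  moreover have "x * x + x\<^sup>2 * x \<le> x * gf x S' b N + x\<^sup>2 * gf x S' (rung b) N"
    using IH x by (intro add_mono mult_left_mono) auto
  moreover have "x * 1 \<le> x * (x + x\<^sup>2)" using x by (intro mult_left_mono) auto
  ultimately show ?case by (simp add: algebra_simps)
qed

lemma connective_constant_ladder_ge:
  assumes x: "x > 0" "x + x\<^sup>2 \<ge> 1"
  shows "1 / x \<le> connective_constant V E"
proof -
  obtain v where v: "v \<in> V" using infinite_V by fastforce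
  have "x \<le> gf x {} v N" for N
    using gf_ladder_ge[OF x, of "{}" v] v infinite_V comp_empty[OF v] by simp
  from root_limit_ge[OF x(1) x(1) this connective_constant_limit[OF v]] show ?thesis .
qed

text \<open>
  The weight \<open>11/2\<close> belongs to walks that have just crossed a rung and turned back, so that the next
  rung would close a square; the weights solve the recursion for any growth rate \<open>l \<ge> 1.89\<close>.
\<close>

fun ladder_weight :: "'a list \<Rightarrow> real" where
  "ladder_weight (z # y # t # x # r) =
     (if y = rung z then 17/2 else if t = rung y \<and> x = rung z then 11/2 else 10)"
| "ladder_weight _ = 10"

lemma ladder_weight_bounds: "5 \<le> ladder_weight q" "ladder_weight q \<le> 10"
  by (cases q rule: ladder_weight.cases; simp)+

text \<open>The exact recursion behind the three weights has growth rate the root 1.839... of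
  \<open>l ^ 3 = l ^ 2 + l + 1\<close>. Any rate below \<open>y2\<close> is enough, so the weights
  are rounded; the inequalities are \<open>17/2 * l \<ge> 11/2 + 10\<close>,
  \<open>11/2 * l \<ge> 10\<close> and \<open>10 * l \<ge> 17/2 + 10\<close>.\<close>

lemma ladder_weight_extensions:
  assumes l: "l \<ge> 189/100"
    and q: "distinct (z # y # t # x # r)" "y \<in> nbrs z" "t \<in> nbrs y"
  shows "(\<Sum>w\<in>nbrs z - set (z # y # t # x # r). ladder_weight (w # z # y # t # x # r))
           \<le> l * ladder_weight (z # y # t # x # r)"
proof -
  define W where "W = (\<lambda>w. ladder_weight (w # z # y # t # x # r))"
  define Y where "Y = nbrs z - set (z # y # t # x # r)"
  have V: "z \<in> V" "y \<in> V" "t \<in> V" using q nbrsD by blast+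
  have W: "0 \<le> W w" "W w \<le> 10" for w
    using ladder_weight_bounds[of "w # z # y # t # x # r"] unfolding W_def by linarith+
  have sumle: "sum W Y \<le> sum W Z" if "Y \<subseteq> Z" "finite Z" for Z
    using that W by (intro sum_mono2) auto
  have "sum W Y \<le> l * ladder_weight (z # y # t # x # r)"
  proof (cases "y = rung z")
    case True
    have ry: "rung y = z" using True rung_rung[OF V(1)] by simp
    have tz: "t \<noteq> z" using q(1) by auto
    define h where "h = rung t"
    have h: "h \<in> nbrs z" using rung_step[OF q(3)] tz ry by (simp add: h_def)
    have hy: "h \<noteq> y" using rung_rung[OF V(3)] ry tz by (auto simp: h_def)
    obtain g where g: "nbrs z = {y, h, g}" "g \<noteq> y" "g \<noteq> h" using nbrs_third[OF q(2) h] hy by blast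
    have "W h = 11/2" using rung_rung[OF V(3)] tz True by (simp add: W_def h_def)
    moreover have "sum W Y \<le> sum W {h, g}" using g by (intro sumle) (auto simp: Y_def)
    moreover have "sum W {h, g} = W h + W g" using g by simp
    moreover have "l * ladder_weight (z # y # t # x # r) = l * (17/2)" using True by simp
    ultimately show ?thesis using W(2)[of g] l by linarith
  next
    case False
    obtain g where g: "nbrs z = {y, rung z, g}" "g \<noteq> y" "g \<noteq> rung z"
      using nbrs_third[OF q(2) rung_nbrs[OF V(1)] False] by blast
    show ?thesis
    proof (cases "t = rung y \<and> x = rung z")
      case True
      have "sum W Y \<le> sum W {g}" using g True by (intro sumle) (auto simp: Y_def)
      moreover have "ladder_weight (z # y # t # x # r) = 11/2" using True False by simp
      ultimately show ?thesis using W(2)[of g] l by simp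
    next
      case nu: False
      have "W (rung z) = 17/2" using rung_rung[OF V(1)] by (simp add: W_def)
      moreover have "sum W Y \<le> sum W {rung z, g}" using g by (intro sumle) (auto simp: Y_def)
      moreover have "sum W {rung z, g} = W (rung z) + W g" using g by simp
      moreover have "ladder_weight (z # y # t # x # r) = 10" using nu False by simp
      ultimately show ?thesis using W(2)[of g] l by simp
    qed
  qed
  thus ?thesis by (simp add: W_def Y_def)
qed

lemma connective_constant_ladder_le:
  assumes l: "l \<ge> 189/100"
  shows "connective_constant V E \<le> l"
proof -
  obtain v where v: "v \<in> V" using infinite_V by fastforce
  have step: "(\<Sum>w\<in>nbrs (last p) - set p. ladder_weight (w # rev p)) \<le> l * ladder_weight (rev p)"
    if n: "n \<ge> 3" and p: "p \<in> saws V E n v" for n p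
  proof -
    have w: "walk V E p" "distinct p" "length p \<ge> 4" using n p by (auto simp: saws_def)
    have "\<exists>z y t x r. q = z # y # t # x # r" if "length q \<ge> 4" for q :: "'a list"
      using that by (auto simp: numeral_eq_Suc Suc_le_length_iff)
    from this[of "rev p"] obtain z y t x r where rp: "rev p = z # y # t # x # r" using w(3) by auto
    have pe: "p = rev r @ [x, t, y, z]" using arg_cong[OF rp, of rev] by simp
    have yz: "y \<in> nbrs z" "t \<in> nbrs y"
      using w(1) pe by (auto simp: walk_def successively_append_iff nbrs_def insert_commute)
    have "distinct (z # y # t # x # r)" using w(2) rp distinct_rev by metis
    moreover have "set p = set (z # y # t # x # r)" using rp set_rev by metis
    moreover have "last p = z" using pe by simp
    ultimately show ?thesis using ladder_weight_extensions[OF l _ yz] rp by (simp only:)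
  qed
  define C where "C = (1 + (\<Sum>p\<in>saws V E 3 v. ladder_weight (rev p))) / 5 / l ^ 3"
  have "(\<Sum>p\<in>saws V E 3 v. ladder_weight (rev p)) \<ge> 0"
    using ladder_weight_bounds(1) by (intro sum_nonneg) (meson le_numeral_extra order_trans zero_le_numeral)
  hence "C > 0" using l by (simp add: C_def)
  moreover have "real (num_saws V E n v) \<le> C * l ^ n" if "n \<ge> 3" for n
    unfolding C_def
    using num_saws_le_weight[of 3 n l 5 ladder_weight v] that l ladder_weight_bounds(1) step by simp
  ultimately show ?thesis
    using root_limit_le[OF connective_constant_limit[OF v], of 3 C l] l by simp
qed

end

section \<open>Squares arranged in a tree\<close>

context cubic_graph
begin

lemma walk_of_comp:
  assumes "u \<in> V" "w \<in> component S u"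
  shows "\<exists>p. walk V E p \<and> hd p = u \<and> last p = w"
proof -
  have "component S u \<subseteq> {w. \<exists>p. walk V E p \<and> hd p = u \<and> last p = w}"
  proof (rule comp_least)
    show "u \<in> {w. \<exists>p. walk V E p \<and> hd p = u \<and> last p = w}"
      using assms(1) by (auto simp: walk_def intro!: exI[of _ "[u]"])
    fix w z assume "w \<in> {w. \<exists>p. walk V E p \<and> hd p = u \<and> last p = w}" and z: "z \<in> nbrs w"
    then obtain p where p: "walk V E p" "hd p = u" "last p = w" by auto
    hence ne: "p \<noteq> []" by (auto simp: walk_def)
    have "walk V E [z]" using nbrsD(2)[OF z] by (simp add: walk_def)
    hence "walk V E (p @ [z])" using walk_append_iff[OF ne, of "[z]"] p z by simp
    thus "z \<in> {w. \<exists>p. walk V E p \<and> hd p = u \<and> last p = w}"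
      using p ne by (auto intro!: exI[of _ "p @ [z]"])
  qed
  thus ?thesis using assms by blast
qed

end

lemma automorphism_comp:
  assumes "automorphism V E f" "automorphism V E g"
  shows "automorphism V E (f \<circ> g)"
proof -
  have "\<And>u. u \<in> V \<Longrightarrow> g u \<in> V" using assms(2) by (auto simp: automorphism_def bij_betw_def)
  thus ?thesis using assms by (auto simp: automorphism_def intro: bij_betw_trans)
qed

lemma automorphism_inv_into:
  assumes "automorphism V E f"
  shows "automorphism V E (inv_into V f)"
proof -
  have b: "bij_betw f V V" using assms by (simp add: automorphism_def)
  have i: "bij_betw (inv_into V f) V V" by (rule bij_betw_inv_into[OF b])
  hence "inv_into V f u \<in> V" "f (inv_into V f u) = u" if "u \<in> V" for u
    using that b by (auto simp: bij_betw_def f_inv_into_f)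
  thus ?thesis using assms i unfolding automorphism_def by metis
qed

lemma vertex_transitiveI:
  assumes "\<And>v. v \<in> V \<Longrightarrow> \<exists>f. automorphism V E f \<and> f r = v" "r \<in> V"
  shows "vertex_transitive V E"
  unfolding vertex_transitive_def
proof (intro ballI)
  fix u v assume uv: "u \<in> V" "v \<in> V"
  obtain f where f: "automorphism V E f" "f r = u" using assms uv by blast
  obtain g where g: "automorphism V E g" "g r = v" using assms uv by blast
  have "inj_on f V" using f by (auto simp: automorphism_def bij_betw_def)
  hence "inv_into V f u = r" using f assms(2) inv_into_f_eq by metis
  hence "(g \<circ> inv_into V f) u = v" using g by simp
  thus "\<exists>f. automorphism V E f \<and> f u = v"
    using automorphism_comp[OF g(1) automorphism_inv_into[OF f(1)]] by blast
qed

text \<open>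
  Squares arranged in a 4-regular tree: the pair \<open>(t, i)\<close> is corner \<open>i\<close> of the square at the tree
  vertex \<open>t\<close>, a reduced word in four involutions, and \<open>step i t\<close> multiplies \<open>t\<close> by the \<open>i\<close>-th
  involution.
\<close>

definition reduced :: "nat list \<Rightarrow> bool" where
  "reduced t \<longleftrightarrow> set t \<subseteq> {..<4} \<and> distinct_adj t"

definition step :: "nat \<Rightarrow> nat list \<Rightarrow> nat list" where
  "step i t = (if t \<noteq> [] \<and> hd t = i then tl t else i # t)"

lemma reduced_Nil [simp]: "reduced []"
  by (simp add: reduced_def)

lemma reduced_Cons: "reduced (i # t) \<longleftrightarrow> i < 4 \<and> reduced t \<and> (t = [] \<or> hd t \<noteq> i)"
  by (cases t) (auto simp: reduced_def)

lemma reduced_step: "reduced t \<Longrightarrow> i < 4 \<Longrightarrow> reduced (step i t)"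
  by (cases t) (auto simp: step_def reduced_Cons)

lemma step_step: "reduced t \<Longrightarrow> step i (step i t) = t"
  by (cases t) (auto simp: step_def reduced_Cons)

lemma step_Cons: "reduced (i # t) \<Longrightarrow> step i t = i # t"
  by (auto simp: step_def reduced_Cons)

lemma step_neq: "step i t \<noteq> t"
  by (cases t) (auto simp: step_def)

lemma step_hd: "step i (i # t) = t"
  by (simp add: step_def)

text \<open>Since \<open>step\<close> acts at the head of a word, multiplication by a generator at
  the far end commutes with it. These are the colour-preserving translations of the tree as a Cayley
  graph.\<close>

definition lmult :: "nat \<Rightarrow> nat list \<Rightarrow> nat list" where
  "lmult j s = foldr step s [j]"

lemma reduced_lmult: "j < 4 \<Longrightarrow> reduced s \<Longrightarrow> reduced (lmult j s)"
  by (induction s) (auto simp: lmult_def reduced_Cons intro: reduced_step)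

lemma lmult_step:
  assumes "j < 4" "reduced s"
  shows "lmult j (step i s) = step i (lmult j s)"
proof (cases "s \<noteq> [] \<and> hd s = i")
  case True
  then obtain s' where s: "s = i # s'" by (cases s) auto
  hence "reduced (lmult j s')" using assms reduced_lmult by (auto simp: reduced_Cons)
  thus ?thesis using s step_step by (simp add: lmult_def step_hd)
next
  case False thus ?thesis by (auto simp: lmult_def step_def)
qed

lemma lmult_lmult:
  assumes "j < 4" "reduced s"
  shows "lmult j (lmult j s) = s"
  using assms(2)
proof (induction s)
  case Nil thus ?case by (simp add: lmult_def step_def)
next
  case (Cons i s)
  hence s: "reduced s" by (simp add: reduced_Cons)
  have "lmult j (lmult j (i # s)) = lmult j (step i (lmult j s))" by (simp add: lmult_def)
  also have "\<dots> = step i (lmult j (lmult j s))" using lmult_step reduced_lmult assms s by simp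
  also have "\<dots> = i # s" using Cons s step_Cons by simp
  finally show ?case .
qed

text \<open>Induction on the word: if \<open>f\<close> sends the empty word to \<open>t\<close>,
  then \<open>f\<close> after \<open>lmult j\<close> sends it to
  \<open>f (step j []) = step j t\<close>, which is \<open>j # t\<close>.\<close>

lemma ex_tree_translation:
  assumes "reduced t"
  shows "\<exists>f. bij_betw f {s. reduced s} {s. reduced s} \<and>
             (\<forall>s i. reduced s \<longrightarrow> i < 4 \<longrightarrow> f (step i s) = step i (f s)) \<and> f [] = t"
  using assms
proof (induction t)
  case Nil show ?case by (rule exI[of _ id]) (auto simp: bij_betw_def)
next
  case (Cons j t)
  have j: "j < 4" and t: "reduced t" using Cons.prems by (auto simp: reduced_Cons)
  then obtain f where f: "bij_betw f {s. reduced s} {s. reduced s}"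
    "\<And>s i. reduced s \<Longrightarrow> i < 4 \<Longrightarrow> f (step i s) = step i (f s)" "f [] = t"
    using Cons.IH by blast
  have "bij_betw (lmult j) {s. reduced s} {s. reduced s}"
    using reduced_lmult lmult_lmult j
    by (intro bij_betw_byWitness[where f' = "lmult j"]) auto
  hence "bij_betw (f \<circ> lmult j) {s. reduced s} {s. reduced s}" using f(1) by (rule bij_betw_trans)
  moreover have "(f \<circ> lmult j) (step i s) = step i ((f \<circ> lmult j) s)" if "reduced s" "i < 4" for s i
    using that lmult_step f(2) reduced_lmult j by simp
  moreover have "(f \<circ> lmult j) [] = j # t"
  proof -
    have "lmult j [] = step j []" by (simp add: lmult_def step_def)
    thus ?thesis using f(2)[of "[]" j] f(3) j step_Cons[OF Cons.prems] by simp
  qed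
  ultimately show ?case by blast
qed

section \<open>The tree of squares and its automorphisms\<close>

definition tree_vertices :: "(nat list \<times> nat) set" where
  "tree_vertices = {(t, i). reduced t \<and> i < 4}"

text \<open>Adding 3 is subtracting 1 modulo 4. The outer edge of a corner joins it to the corner
  with the same index, so one step along it and back uses the same involution.\<close>

fun tree_nbrs :: "nat list \<times> nat \<Rightarrow> (nat list \<times> nat) set" where
  "tree_nbrs (t, i) = {(t, (i + 1) mod 4), (t, (i + 3) mod 4), (step i t, i)}"

lemma tree_nbrs_sym:
  assumes "p \<in> tree_vertices" "q \<in> tree_nbrs p"
  shows "q \<in> tree_vertices" "p \<in> tree_nbrs q"
proof -
  obtain t i where p: "p = (t, i)" by (cases p)
  have i: "i < 4" "reduced t" using assms p by (auto simp: tree_vertices_def)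
  hence "i = 0 \<or> i = 1 \<or> i = 2 \<or> i = 3" by auto
  thus "q \<in> tree_vertices" "p \<in> tree_nbrs q"
    using assms(2) p i reduced_step step_step by (auto simp: tree_vertices_def)
qed

lemma card_tree_nbrs:
  assumes "p \<in> tree_vertices"
  shows "card (tree_nbrs p) = 3"
proof -
  obtain t i where p: "p = (t, i)" by (cases p)
  have i: "i < 4" using assms p by (auto simp: tree_vertices_def)
  hence "i = 0 \<or> i = 1 \<or> i = 2 \<or> i = 3" by auto
  thus ?thesis using p step_neq[of i t] step_neq[of i t, symmetric] by auto
qed

lemma tree_nbrs_irrefl: "p \<in> tree_vertices \<Longrightarrow> p \<notin> tree_nbrs p"
  using step_neq[symmetric] by (cases p) (auto simp: tree_vertices_def, presburger+)

lemma tree_no_triangle: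
  assumes "p \<in> tree_vertices" "q \<in> tree_nbrs p" "r \<in> tree_nbrs p"
  shows "r \<notin> tree_nbrs q"
proof -
  obtain t i where p: "p = (t, i)" by (cases p)
  have i: "i < 4" using assms p by (auto simp: tree_vertices_def)
  hence "i = 0 \<or> i = 1 \<or> i = 2 \<or> i = 3" by auto
  thus ?thesis
    using assms(2,3) p step_neq[of _ t] step_neq[of _ t, symmetric] step_neq[of i "step i t"]
      step_neq[of i "step i t", symmetric]
    by (elim disjE) auto
qed

lemma infinite_tree_vertices: "infinite tree_vertices"
proof -
  define alt where "alt = rec_nat [] (\<lambda>n t. (n mod 2) # t)"
  have alt: "alt 0 = []" "alt (Suc n) = (n mod 2) # alt n" for n by (simp_all add: alt_def)
  have "reduced (alt n)" for n
  proof (induction n)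
    case (Suc n) thus ?case by (cases n) (auto simp: alt reduced_Cons, presburger+)
  qed (simp add: alt)
  hence "range (\<lambda>n. (alt n, 0)) \<subseteq> tree_vertices" by (auto simp: tree_vertices_def)
  moreover have "length (alt n) = n" for n by (induction n) (auto simp: alt)
  hence "inj (\<lambda>n. (alt n, 0 :: nat))" by (metis (mono_tags, lifting) injI prod.inject)
  ultimately show ?thesis using finite_subset range_inj_infinite by blast
qed

text \<open>Translations of the tree preserve the corner index. Shifting all colours cyclically, in
  the words and in the corners alike, respects the squares and moves one corner to another.\<close>

definition rotate_colour :: "nat \<Rightarrow> nat \<Rightarrow> nat" where
  "rotate_colour k c = (c + k) mod 4"

lemma rotate_colour_less [simp]: "rotate_colour k c < 4"
  by (simp add: rotate_colour_def)

lemma rotate_colour_inverse: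
  assumes "k < 4" "c < 4"
  shows "rotate_colour (4 - k) (rotate_colour k c) = c" "rotate_colour k (rotate_colour (4 - k) c) = c"
proof -
  have "((c + k) mod 4 + (4 - k)) mod 4 = (c + k + (4 - k)) mod 4" by (rule mod_add_left_eq)
  moreover have "((c + (4 - k)) mod 4 + k) mod 4 = (c + (4 - k) + k) mod 4" by (rule mod_add_left_eq)
  moreover have "c + k + (4 - k) = c + 4" "c + (4 - k) + k = c + 4" using assms(1) by simp_all
  ultimately show "rotate_colour (4 - k) (rotate_colour k c) = c"
    "rotate_colour k (rotate_colour (4 - k) c) = c"
    using assms(2) by (simp_all only: rotate_colour_def) simp_all
qed

lemma rotate_colour_eq:
  assumes "k < 4" "c < 4" "d < 4"
  shows "rotate_colour k c = rotate_colour k d \<longleftrightarrow> c = d"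
  using rotate_colour_inverse(1) assms by metis

lemma reduced_map_rotate:
  assumes "k < 4" "reduced t"
  shows "reduced (map (rotate_colour k) t)"
  using assms(2)
proof (induction t)
  case (Cons i t)
  have "t \<noteq> [] \<Longrightarrow> hd t < 4" using Cons.prems by (cases t) (auto simp: reduced_Cons)
  thus ?case using Cons by (auto simp: reduced_Cons hd_map rotate_colour_eq[OF assms(1)])
qed simp

lemma map_rotate_step:
  assumes "k < 4" "reduced t" "i < 4"
  shows "map (rotate_colour k) (step i t) = step (rotate_colour k i) (map (rotate_colour k) t)"
  using assms by (cases t) (auto simp: step_def reduced_Cons rotate_colour_eq)

lemma ex_tree_automorphism:
  assumes "p \<in> tree_vertices"
  shows "\<exists>f. bij_betw f tree_vertices tree_vertices \<and>
             (\<forall>q\<in>tree_vertices. tree_nbrs (f q) = f ` tree_nbrs q) \<and> f ([], 0) = p"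
proof -
  obtain t k where p: "p = (t, k)" "reduced t" "k < 4" using assms by (auto simp: tree_vertices_def)
  obtain g where g: "bij_betw g {s. reduced s} {s. reduced s}"
    "\<And>s i. reduced s \<Longrightarrow> i < 4 \<Longrightarrow> g (step i s) = step i (g s)" "g [] = t"
    using ex_tree_translation[OF p(2)] by blast
  define rot where "rot = (\<lambda>k (s, i). (map (rotate_colour k) s, rotate_colour k i))"
  define tr where "tr = (\<lambda>(s :: nat list, i :: nat). (g s, i))"
  have inv: "map (rotate_colour k') (map (rotate_colour k'') s) = s"
    if "reduced s" "\<And>c. c < 4 \<Longrightarrow> rotate_colour k' (rotate_colour k'' c) = c" for s k' k''
    using that by (auto simp: reduced_def intro!: map_idI)
  \<comment> \<open>For \<open>k = 0\<close> the inverse shift is by 4, outside the range of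
    \<open>reduced_map_rotate\<close>.\<close>
  have four: "reduced (map (rotate_colour (4 - k)) s)" if "reduced s" for s
  proof (cases "k = 0")
    case True
    have "map (rotate_colour 4) s = s"
      using that by (intro map_idI) (auto simp: rotate_colour_def reduced_def)
    thus ?thesis using True that by simp
  next
    case False thus ?thesis using reduced_map_rotate[of "4 - k" s] that by simp
  qed
  have brot: "bij_betw (rot k) tree_vertices tree_vertices"
  proof (rule bij_betw_byWitness[where f' = "rot (4 - k)"])
    show "\<forall>a\<in>tree_vertices. rot (4 - k) (rot k a) = a"
      using inv[of _ "4 - k" k] rotate_colour_inverse[OF p(3)] by (auto simp: rot_def tree_vertices_def simp del: map_map)
    show "\<forall>a\<in>tree_vertices. rot k (rot (4 - k) a) = a"
      using inv[of _ k "4 - k"] rotate_colour_inverse[OF p(3)] by (auto simp: rot_def tree_vertices_def simp del: map_map)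
  qed (use reduced_map_rotate[OF p(3)] four in \<open>auto simp: rot_def tree_vertices_def\<close>)
  have gr: "reduced (g s)" if "reduced s" for s using bij_betwE[OF g(1)] that by blast
  have btr: "bij_betw tr tree_vertices tree_vertices"
  proof (rule bij_betw_byWitness[where f' = "\<lambda>(s, i). (inv_into {s. reduced s} g s, i)"])
    show "\<forall>a\<in>tree_vertices. (\<lambda>(s, i). (inv_into {s. reduced s} g s, i)) (tr a) = a"
      using bij_betw_inv_into_left[OF g(1)] by (auto simp: tr_def tree_vertices_def)
    show "\<forall>a\<in>tree_vertices. tr ((\<lambda>(s, i). (inv_into {s. reduced s} g s, i)) a) = a"
      using bij_betw_inv_into_right[OF g(1)] by (auto simp: tr_def tree_vertices_def)
    show "(\<lambda>(s, i). (inv_into {s. reduced s} g s, i)) ` tree_vertices \<subseteq> tree_vertices"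
      using bij_betw_inv_into[OF g(1)] by (auto simp: tree_vertices_def bij_betw_def)
  qed (use gr in \<open>auto simp: tr_def tree_vertices_def\<close>)
  have nrot: "tree_nbrs (rot k q) = rot k ` tree_nbrs q" if q_in: "q \<in> tree_vertices" for q
  proof -
    obtain s i where q: "q = (s, i)" "reduced s" "i < 4" using q_in by (auto simp: tree_vertices_def)
    have "rotate_colour k ((i + c) mod 4) = (rotate_colour k i + c) mod 4" for c
      by (simp add: rotate_colour_def mod_simps add_ac)
    thus ?thesis
      by (simp only: q(1) rot_def prod.case tree_nbrs.simps image_insert image_empty
          map_rotate_step[OF p(3) q(2,3)])
  qed
  have ntr: "tree_nbrs (tr q) = tr ` tree_nbrs q" if "q \<in> tree_vertices" for q
    using that g(2) by (auto simp: tr_def tree_vertices_def)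
  have "bij_betw (tr \<circ> rot k) tree_vertices tree_vertices" using brot btr by (rule bij_betw_trans)
  moreover have "tree_nbrs ((tr \<circ> rot k) q) = (tr \<circ> rot k) ` tree_nbrs q" if "q \<in> tree_vertices" for q
  proof -
    have "rot k q \<in> tree_vertices" using that brot by (auto simp: bij_betw_def)
    thus ?thesis using nrot[OF that] ntr by (simp add: image_image)
  qed
  moreover have "(tr \<circ> rot k) ([], 0) = p"
    using p g(3) by (simp add: tr_def rot_def rotate_colour_def)
  ultimately show ?thesis by blast
qed

section \<open>The tree of squares as a graph on the natural numbers\<close>

declare tree_nbrs.simps [simp del]

definition enc :: "nat list \<times> nat \<Rightarrow> nat" where
  "enc = to_nat"

definition tree_V :: "nat set" where
  "tree_V = enc ` tree_vertices"

definition tree_E :: "nat set set" where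
  "tree_E = {{enc p, enc q} |p q. p \<in> tree_vertices \<and> q \<in> tree_nbrs p}"

lemma enc_eq [simp]: "enc p = enc q \<longleftrightarrow> p = q"
  by (simp add: enc_def)

lemma tree_E_iff:
  assumes "p \<in> tree_vertices"
  shows "{enc p, x} \<in> tree_E \<longleftrightarrow> x \<in> enc ` tree_nbrs p"
proof
  assume "{enc p, x} \<in> tree_E"
  then obtain p' q' where p': "p' \<in> tree_vertices" "q' \<in> tree_nbrs p'" "{enc p, x} = {enc p', enc q'}"
    unfolding tree_E_def by blast
  hence "(p = p' \<and> x = enc q') \<or> (p = q' \<and> x = enc p')" by (auto simp: doubleton_eq_iff)
  thus "x \<in> enc ` tree_nbrs p" using p'(2) tree_nbrs_sym(2)[OF p'(1,2)] by blast
next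
  assume "x \<in> enc ` tree_nbrs p" thus "{enc p, x} \<in> tree_E" using assms unfolding tree_E_def by blast
qed

text \<open>Established before connectedness and transitivity, so that components and generating
  functions are already available for this graph.\<close>

lemma tree_cubic_graph: "cubic_graph tree_V tree_E"
proof
  show "simple_graph tree_V tree_E"
    unfolding simple_graph_def
  proof
    fix e assume "e \<in> tree_E"
    then obtain p q where pq: "p \<in> tree_vertices" "q \<in> tree_nbrs p" "e = {enc p, enc q}"
      unfolding tree_E_def by blast
    moreover have "q \<in> tree_vertices" "p \<noteq> q" using tree_nbrs_sym tree_nbrs_irrefl pq by blast+
    ultimately show "e \<subseteq> tree_V \<and> card e = 2" by (auto simp: tree_V_def)
  qed
  show "cubic tree_V tree_E"
    unfolding cubic_def
  proof
    fix v assume "v \<in> tree_V"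
    then obtain p where p: "p \<in> tree_vertices" "v = enc p" by (auto simp: tree_V_def)
    have "bij_betw (\<lambda>q. {v, enc q}) (tree_nbrs p) {e \<in> tree_E. v \<in> e}"
    proof (rule bij_betwI')
      fix e assume e: "e \<in> {e \<in> tree_E. v \<in> e}"
      then obtain x where "e = {v, x}" unfolding tree_E_def by blast
      thus "\<exists>q\<in>tree_nbrs p. e = {v, enc q}" using e p tree_E_iff[OF p(1), of x] by auto
    qed (use p tree_E_iff[OF p(1)] in \<open>auto simp: doubleton_eq_iff\<close>)
    thus "degree tree_E v = 3"
      using card_tree_nbrs[OF p(1)] by (simp add: degree_def bij_betw_same_card)
  qed
qed

interpretation tree: cubic_graph tree_V tree_E
  by (rule tree_cubic_graph)

lemma tree_nbrs_enc: "p \<in> tree_vertices \<Longrightarrow> tree.nbrs (enc p) = enc ` tree_nbrs p"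
  using tree_E_iff by (auto simp: tree.nbrs_def)

lemma tree_vertices_iff [simp]: "(t, i) \<in> tree_vertices \<longleftrightarrow> reduced t \<and> i < 4"
  by (simp add: tree_vertices_def)

text \<open>Induction on the word: from corner \<open>j\<close> of the square at \<open>t\<close>
  the outer edge leads to corner \<open>j\<close> of the square at \<open>j # t\<close>, and turning
  inside that square reaches the other corners.\<close>

lemma tree_reachable:
  assumes "reduced t" "i < 4"
  shows "enc (t, i) \<in> tree.component {} (enc ([], 0))"
  using assms
proof (induction t arbitrary: i)
  have square: "enc (t, i) \<in> tree.component {} u"
    if "enc (t, j) \<in> tree.component {} u" "reduced t" "j < 4" "i < 4" for t i j u
  proof -
    have s: "enc (t, (c + 1) mod 4) \<in> tree.component {} u" if "enc (t, c) \<in> tree.component {} u" "c < 4" for c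
      using tree.comp_step[OF that(1)] tree_nbrs_enc[of "(t, c)"] that(2) \<open>reduced t\<close>
      by (simp add: tree_nbrs.simps)
    have "enc (t, (j + n) mod 4) \<in> tree.component {} u" for n
    proof (induction n)
      case (Suc n) thus ?case using s[OF Suc] by (simp add: mod_simps add_ac)
    qed (use that in simp)
    \<comment> \<open>Turning this many times leads from corner \<open>j\<close> to corner
      \<open>i\<close>, since the index becomes \<open>4 + i\<close> modulo 4.\<close>
    from this[of "4 - j + i"] show ?thesis using that(3,4) by (simp add: add.assoc[symmetric])
  qed
  {
    case Nil thus ?case using square[of "[]" 0 "enc ([], 0)" i] tree.comp_refl by simp
  next
    case (Cons j t)
    hence t: "reduced t" "j < 4" by (auto simp: reduced_Cons)
    have "enc (step j t, j) \<in> tree.component {} (enc ([], 0))"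
      using tree.comp_step[OF Cons.IH[OF t]] tree_nbrs_enc[of "(t, j)"] t by (simp add: tree_nbrs.simps)
    thus ?case using square[of "j # t" j _ i] Cons.prems t step_Cons by simp
  }
qed

lemma tree_girth4: "cubic_girth4 tree_V tree_E"
proof
  have root: "enc ([], 0) \<in> tree_V" by (simp add: tree_V_def)
  show "infinite tree_V"
    using infinite_tree_vertices finite_image_iff[of enc tree_vertices] by (auto simp: tree_V_def inj_on_def)
  have component: "v \<in> tree.component {} (enc ([], 0))" if "v \<in> tree_V" for v
    using that tree_reachable by (auto simp: tree_V_def)
  show "connected_graph tree_V tree_E"
    unfolding connected_graph_def
  proof (intro conjI ballI)
    show "tree_V \<noteq> {}" using root by auto
    fix u v assume "u \<in> tree_V" "v \<in> tree_V"
    moreover have "v \<in> tree.component {} u"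
      using tree.comp_eq[of "enc ([], 0)" "{}" u] component calculation by simp
    ultimately show "\<exists>p. walk tree_V tree_E p \<and> hd p = u \<and> last p = v"
      using tree.walk_of_comp by blast
  qed
  show "vertex_transitive tree_V tree_E"
  proof (rule vertex_transitiveI[OF _ root])
    fix v assume "v \<in> tree_V"
    then obtain p where p: "p \<in> tree_vertices" "v = enc p" by (auto simp: tree_V_def)
    obtain f where f: "bij_betw f tree_vertices tree_vertices"
      "\<And>q. q \<in> tree_vertices \<Longrightarrow> tree_nbrs (f q) = f ` tree_nbrs q" "f ([], 0) = p"
      using ex_tree_automorphism[OF p(1)] by blast
    define dec where "dec = inv_into tree_vertices enc"
    define h where "h = enc \<circ> f \<circ> dec"
    have e: "bij_betw enc tree_vertices tree_V" by (auto simp: bij_betw_def inj_on_def tree_V_def)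
    have dec: "dec (enc q) = q" if "q \<in> tree_vertices" for q
      using bij_betw_inv_into_left[OF e that] by (simp add: dec_def)
    have "bij_betw dec tree_V tree_vertices" unfolding dec_def by (rule bij_betw_inv_into[OF e])
    hence "bij_betw h tree_V tree_V" unfolding h_def
      using f(1) e by (blast intro: bij_betw_trans)
    moreover have "{h x, h y} \<in> tree_E \<longleftrightarrow> {x, y} \<in> tree_E" if xy: "x \<in> tree_V" "y \<in> tree_V" for x y
    proof -
      obtain q r where q: "q \<in> tree_vertices" "x = enc q" and r: "r \<in> tree_vertices" "y = enc r"
        using xy by (auto simp: tree_V_def)
      have fq: "f q \<in> tree_vertices" using q f(1) by (auto simp: bij_betw_def)
      have "{h x, h y} \<in> tree_E \<longleftrightarrow> f r \<in> f ` tree_nbrs q"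
        using tree_E_iff[OF fq, of "enc (f r)"] q r dec f(2) by (auto simp: h_def)
      also have "\<dots> \<longleftrightarrow> r \<in> tree_nbrs q"
        using f(1) r tree_nbrs_sym(1)[OF q(1)] by (auto simp: bij_betw_def dest: inj_onD)
      also have "\<dots> \<longleftrightarrow> {x, y} \<in> tree_E" using tree_E_iff[OF q(1), of y] q r by auto
      finally show ?thesis .
    qed
    moreover have "h (enc ([], 0)) = v" using dec f(3) p(2) by (simp add: h_def)
    ultimately show "\<exists>f. automorphism tree_V tree_E f \<and> f (enc ([], 0)) = v"
      by (auto simp: automorphism_def)
  qed
  show "girth tree_V tree_E = 4"
  proof (rule antisym)
    have "{enc ([], 0), enc ([], 1)} \<in> tree_E" "{enc ([], 1), enc ([], 2)} \<in> tree_E"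
      "{enc ([], 2), enc ([], 3)} \<in> tree_E" "{enc ([], 3), enc ([], 0)} \<in> tree_E"
      by (simp_all add: tree_E_iff tree_nbrs.simps)
    hence "cycle tree_V tree_E [enc ([], 0), enc ([], 1), enc ([], 2), enc ([], 3)]"
      by (simp add: cycle_def walk_def tree_V_def)
    moreover have "length [enc ([], 0), enc ([], 1), enc ([], 2), enc ([], 3)] = 4" by simp
    ultimately have "girth tree_V tree_E \<le> enat 4"
      unfolding girth_def by (metis (mono_tags, lifting) INF_lower mem_Collect_eq)
    thus "girth tree_V tree_E \<le> 4" by (simp add: numeral_eq_enat)
    have "4 \<le> length c" if c: "cycle tree_V tree_E c" for c
    proof (rule ccontr)
      assume "\<not> 4 \<le> length c"
      hence "length c = 3" using c by (auto simp: cycle_def)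
      then obtain x y z where xyz: "c = [x, y, z]" by (auto simp: numeral_3_eq_3 length_Suc_conv)
      hence V: "x \<in> tree_V" and E: "y \<in> tree.nbrs x" "z \<in> tree.nbrs y" "z \<in> tree.nbrs x"
        using c by (auto simp: cycle_def walk_def tree.nbrs_def insert_commute)
      then obtain p where p: "p \<in> tree_vertices" "x = enc p" by (auto simp: tree_V_def)
      then obtain q r where qr: "q \<in> tree_nbrs p" "r \<in> tree_nbrs p" "y = enc q" "z = enc r"
        using E tree_nbrs_enc by auto
      hence "r \<in> tree_nbrs q" using E(2) tree_nbrs_enc[of q] tree_nbrs_sym(1)[OF p(1)] by auto
      thus False using tree_no_triangle[OF p(1) qr(1,2)] by simp
    qed
    thus "4 \<le> girth tree_V tree_E"
      unfolding girth_def by (intro INF_greatest) (simp add: numeral_eq_enat)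
  qed
qed

text \<open>No exit is ever blocked: a walk entering through the edge to the parent keeps the whole
  subtree of words ending in \<open>t\<close> free, and each of the other three corners leads one
  level deeper. The constant \<open>x\<close> is then a fixed point of the square recursion, by the
  equation for \<open>zeta\<close>. At the root one of the four branches is left aside.\<close>

lemma tree_gf_ge:
  assumes x: "x > 0" "2 * x\<^sup>2 * (1 + x + x\<^sup>2) = 1"
    and t: "reduced t" "i < 4" "t = [] \<or> hd t = i" "\<And>r k. enc (r @ t, k) \<notin> S"
  shows "x \<le> tree.gf x S (enc (t, i)) N"
  using t
proof (induction N arbitrary: t i S)
  case 0
  have "enc (t, i) \<notin> S" using 0(4)[of "[]"] by simp
  thus ?case using tree.gf_0[of "enc (t, i)" S x] 0 by (simp add: tree_V_def)
next
  case (Suc N)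
  define a b c where "a = (i + 1) mod 4" and "b = (i + 3) mod 4" and "c = (i + 2) mod 4"
  have abc: "a < 4" "b < 4" "c < 4" "distinct [i, a, c, b]" "c = (a + 1) mod 4" "b = (c + 1) mod 4"
  proof -
    have "i = 0 \<or> i = 1 \<or> i = 2 \<or> i = 3" using Suc.prems(2) by auto
    thus "a < 4" "b < 4" "c < 4" "distinct [i, a, c, b]" "c = (a + 1) mod 4" "b = (c + 1) mod 4"
      unfolding a_def b_def c_def by auto
  qed
  define B where "B = {enc (t, i), enc (t, a), enc (t, c), enc (t, b)}"
  have ext: "reduced (j # t)" "enc (j # t, j) \<in> tree.nbrs (enc (t, j))"
    "x \<le> tree.gf x (S \<union> B) (enc (j # t, j)) N" if j: "j < 4" "j \<noteq> i" for j
  proof -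
    show red: "reduced (j # t)" using Suc.prems j by (auto simp: reduced_Cons)
    show "enc (j # t, j) \<in> tree.nbrs (enc (t, j))"
      using tree_nbrs_enc[of "(t, j)"] j Suc.prems(1) step_Cons[OF red] by (simp add: tree_nbrs.simps)
    have "enc (r @ j # t, k) \<notin> S \<union> B" for r k
    proof -
      \<comment> \<open>Words in the child subtree are longer than \<open>t\<close>, so none belongs
        to the square just crossed.\<close>
      have "length (r @ j # t) \<noteq> length t" by simp
      hence "r @ j # t \<noteq> t" by metis
      thus ?thesis using Suc.prems(4)[of "r @ [j]" k] by (auto simp: B_def)
    qed
    thus "x \<le> tree.gf x (S \<union> B) (enc (j # t, j)) N"
      using Suc.IH[of "j # t" j "S \<union> B"] red j by simp
  qed
  have nb: "enc (t, (j + 1) mod 4) \<in> tree.nbrs (enc (t, j))"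
    "enc (t, (j + 3) mod 4) \<in> tree.nbrs (enc (t, j))" if "j < 4" for j
    using tree_nbrs_enc[of "(t, j)"] Suc.prems(1) that by (simp_all add: tree_nbrs.simps)
  have nb': "enc (t, a) \<in> tree.nbrs (enc (t, i))" "enc (t, c) \<in> tree.nbrs (enc (t, a))"
    "enc (t, b) \<in> tree.nbrs (enc (t, c))" "enc (t, b) \<in> tree.nbrs (enc (t, i))"
    using nb(1)[OF Suc.prems(2)] nb(2)[OF Suc.prems(2)] nb(1)[OF abc(1)] nb(1)[OF abc(3)]
    by (simp_all only: a_def[symmetric] b_def[symmetric] abc(5)[symmetric] abc(6)[symmetric])
  have "B \<inter> S = {}" using Suc.prems(4)[of "[]"] by (auto simp: B_def)
  hence "(x ^ 2 + x ^ 4) * (tree.gf x (S \<union> B) (enc (a # t, a)) N + tree.gf x (S \<union> B) (enc (b # t, b)) N)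
      + 2 * x ^ 3 * tree.gf x (S \<union> B) (enc (c # t, c)) N \<le> tree.gf x S (enc (t, i)) (Suc N)"
    unfolding B_def using x abc(1-4) ext(2) nb' by (intro tree.gf_square) auto
  moreover have "(x ^ 2 + x ^ 4) * (x + x) + 2 * x ^ 3 * x \<le>
      (x ^ 2 + x ^ 4) * (tree.gf x (S \<union> B) (enc (a # t, a)) N + tree.gf x (S \<union> B) (enc (b # t, b)) N)
      + 2 * x ^ 3 * tree.gf x (S \<union> B) (enc (c # t, c)) N"
    using x abc ext(3) by (intro add_mono mult_left_mono) auto
  moreover have "(x ^ 2 + x ^ 4) * (x + x) + 2 * x ^ 3 * x = x * (2 * x\<^sup>2 * (1 + x + x\<^sup>2))"
    by (simp add: algebra_simps eval_nat_numeral)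
  ultimately show ?case using x by simp
qed

lemma tree_connective_constant_ge:
  assumes x: "x > 0" "2 * x\<^sup>2 * (1 + x + x\<^sup>2) = 1"
  shows "1 / x \<le> connective_constant tree_V tree_E"
proof -
  interpret cubic_girth4 tree_V tree_E by (rule tree_girth4)
  have "enc ([], 0) \<in> tree_V" by (simp add: tree_V_def)
  note lim = connective_constant_limit[OF this]
  have "x \<le> tree.gf x {} (enc ([], 0)) N" for N using tree_gf_ge[OF x, of "[]" 0 "{}"] by simp
  from tree.root_limit_ge[OF x(1) x(1) this lim] show ?thesis .
qed

section \<open>Numerical facts and conclusion\<close>

lemma zeta_props:
  shows "0 < zeta" "zeta < 1" "2 * zeta\<^sup>2 * (1 + zeta + zeta\<^sup>2) = 1" "zeta \<le> 100/189"
proof -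
  define g :: "real \<Rightarrow> real" where "g = (\<lambda>x. 2 * x\<^sup>2 * (1 + x + x\<^sup>2))"
  \<comment> \<open>Strict monotonicity makes the positive root unique, so the \<open>LEAST\<close>
    in \<open>zeta\<close> is that root.\<close>
  have mono: "g x < g y" if "0 < x" "x < y" for x y
  proof -
    have "g u = 2 * u ^ 2 + 2 * u ^ 3 + 2 * u ^ 4" for u
      by (simp add: g_def algebra_simps eval_nat_numeral)
    moreover have "x ^ 2 < y ^ 2" "x ^ 3 < y ^ 3" "x ^ 4 < y ^ 4"
      using that by (simp_all add: power_strict_mono)
    ultimately show ?thesis by simp
  qed
  have "\<exists>x\<ge>0. x \<le> 1 \<and> g x = 1"
    by (rule IVT) (auto simp: g_def intro!: continuous_intros)
  then obtain x where x: "0 \<le> x" "g x = 1" by auto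
  hence "x \<noteq> 0" by (auto simp: g_def)
  hence x0: "x > 0" using x by simp
  have "zeta = x" unfolding zeta_def
  proof (rule Least_equality)
    show "x > 0 \<and> 2 * x\<^sup>2 * (1 + x + x\<^sup>2) = 1" using x0 x by (simp add: g_def)
    fix y :: real assume "y > 0 \<and> 2 * y\<^sup>2 * (1 + y + y\<^sup>2) = 1"
    hence "y > 0" "g y = 1" by (auto simp: g_def)
    thus "x \<le> y" using mono[of y x] x by linarith
  qed
  \<comment> \<open>This places \<open>y2\<close> above 1.89, the rate from which the ladder weights
    work.\<close>
  moreover have "g (100/189) \<ge> 1" by (simp add: g_def power2_eq_square)
  hence "x \<le> 100/189" using mono[of "100/189" x] x by linarith
  ultimately show "0 < zeta" "zeta < 1" "2 * zeta\<^sup>2 * (1 + zeta + zeta\<^sup>2) = 1" "zeta \<le> 100/189"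
    using x0 x by (auto simp: g_def)
qed

lemma y1_props:
  shows "0 < y1" "12 * (1 / y1) ^ 6 = 1" "1 / y1 + (1 / y1)\<^sup>2 \<ge> 1"
proof -
  show pos: "0 < y1" by (simp add: y1_def)
  have p6: "y1 ^ 6 = 12" by (simp add: y1_def)
  thus "12 * (1 / y1) ^ 6 = 1" by (simp add: power_one_over)
  \<comment> \<open>The value 8/5 lies between \<open>y1\<close> and the golden ratio, and below the
    latter the ladder condition \<open>y1 * y1 \<le> y1 + 1\<close> holds.\<close>
  have "y1 \<le> 8/5"
  proof (rule ccontr)
    assume "\<not> y1 \<le> 8/5"
    hence "(8/5) ^ 6 \<le> y1 ^ 6" by (intro power_mono) auto
    thus False using p6 by (simp add: eval_nat_numeral)
  qed
  hence "y1 * y1 \<le> 8/5 * y1" using pos by (intro mult_right_mono) auto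
  hence "y1 * y1 \<le> y1 + 1" using \<open>y1 \<le> 8/5\<close> by linarith
  thus "1 / y1 + (1 / y1)\<^sup>2 \<ge> 1" using pos by (simp add: field_simps power2_eq_square)
qed

lemma (in cubic_girth4) connective_constant_bounds:
  "y1 \<le> connective_constant V E \<and> connective_constant V E \<le> y2"
proof (cases "\<forall>v a w b a' w' b'. square v a w b \<longrightarrow> square v a' w' b' \<longrightarrow> {v, a, w, b} = {v, a', w', b'}")
  case True
  interpret unique_square V E by unfold_locales (use True in blast)
  show ?thesis
    using connective_constant_ge[of "1 / y1"] connective_constant_le[of zeta] y1_props zeta_props
    by (simp add: y2_def)
next
  case False
  then obtain rung where "ladder V E rung" using ladder_if_two_squares by blast
  then interpret ladder V E rung .
  have "189/100 \<le> y2" using zeta_props by (simp add: y2_def field_simps)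
  thus ?thesis
    using connective_constant_ladder_ge[of "1 / y1"] connective_constant_ladder_le[of y2] y1_props by simp
qed

lemma cubic_girth4_iff: "infinite_transitive_cubic_girth4 V E \<longleftrightarrow> cubic_girth4 V E"
  by (auto simp: infinite_transitive_cubic_girth4_def cubic_girth4_def cubic_girth4_axioms_def cubic_graph_def)

theorem theorem7p2:
  shows "(\<forall>(V :: 'a set) E. infinite_transitive_cubic_girth4 V E \<longrightarrow>
            y1 \<le> connective_constant V E \<and> connective_constant V E \<le> y2) \<and>
         (\<exists>(V :: nat set) E. infinite_transitive_cubic_girth4 V E \<and>
            connective_constant V E = y2)"
proof (intro conjI allI impI)
  fix V :: "'a set" and E
  assume "infinite_transitive_cubic_girth4 V E"
  then interpret cubic_girth4 V E by (simp add: cubic_girth4_iff)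
  show "y1 \<le> connective_constant V E" "connective_constant V E \<le> y2"
    using connective_constant_bounds by auto
next
  have "connective_constant tree_V tree_E = y2"
    using tree_connective_constant_ge[of zeta] zeta_props
      cubic_girth4.connective_constant_bounds[OF tree_girth4] by (simp add: y2_def)
  thus "\<exists>(V :: nat set) E. infinite_transitive_cubic_girth4 V E \<and> connective_constant V E = y2"
    using tree_girth4 cubic_girth4_iff by blast
qed

end
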